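(* Let $G$ be a finite commutative group, $M\ge1$ an integer, and $0\le q<M$. Consider the problem: given $q$ quantum queries to a function $A:\{0,1,\dots,M-1\}\to G$ drawn uniformly at random among all such functions, output $\sum_{x=0}^{M-1}A(x)$. The maximum success probability of any $q$-query quantum algorithm for this problem is \[\min\left(\frac{\lfloor M/(M-q)\rfloor}{|G|},1\right).\]
   Context: A quantum query to $A$ is the unitary $|x,g,z\rangle\mapsto|x,g+A(x),z\rangle$; queries may be adaptive. Success probability is averaged over uniform $A$. *)

theory Defs
  imports Complex_Main "HOL-Library.FuncSet" "HOL-Library.Cardinality"
begin

text \<open>
  Vectors and matrices over \<open>\<complex>\<close> are indexed by a finite set \<open>B\<close>; entries outside \<open>B\<close> are never
  inspected.
\<close>

definition cinner_on :: "'b set \<Rightarrow> ('b \<Rightarrow> complex) \<Rightarrow> ('b \<Rightarrow> complex) \<Rightarrow> complex" where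
  "cinner_on B u v = (\<Sum>i\<in>B. cnj (u i) * v i)"

definition apply_on :: "'b set \<Rightarrow> ('b \<Rightarrow> 'b \<Rightarrow> complex) \<Rightarrow> ('b \<Rightarrow> complex) \<Rightarrow> 'b \<Rightarrow> complex" where
  "apply_on B U v = (\<lambda>i. \<Sum>j\<in>B. U i j * v j)"

definition unitary_on :: "'b set \<Rightarrow> ('b \<Rightarrow> 'b \<Rightarrow> complex) \<Rightarrow> bool" where
  "unitary_on B U \<longleftrightarrow>
     (\<forall>i\<in>B. \<forall>j\<in>B. (\<Sum>k\<in>B. cnj (U k i) * U k j) = of_bool (i = j)
                \<and> (\<Sum>k\<in>B. U i k * cnj (U j k)) = of_bool (i = j))"

definition psd_on :: "'b set \<Rightarrow> ('b \<Rightarrow> 'b \<Rightarrow> complex) \<Rightarrow> bool" where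
  "psd_on B E \<longleftrightarrow>
     (\<forall>v. Im (cinner_on B v (apply_on B E v)) = 0 \<and> 0 \<le> Re (cinner_on B v (apply_on B E v)))"

text \<open>A general quantum measurement (POVM) with outcomes in the finite type \<open>'g\<close>.\<close>

definition povm_on :: "'b set \<Rightarrow> ('g::finite \<Rightarrow> 'b \<Rightarrow> 'b \<Rightarrow> complex) \<Rightarrow> bool" where
  "povm_on B E \<longleftrightarrow>
     (\<forall>g. psd_on B (E g)) \<and> (\<forall>i\<in>B. \<forall>j\<in>B. (\<Sum>g\<in>UNIV. E g i j) = of_bool (i = j))"

text \<open>
  A basis state \<open>|x,g,z\<rangle>\<close> consists of a query register, a response register and a workspace
  register; the workspace has an arbitrary finite dimension \<open>w\<close>.
\<close>

type_synonym 'g basis = "nat \<times> 'g \<times> nat"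

definition basis_states :: "nat \<Rightarrow> nat \<Rightarrow> 'g basis set" where
  "basis_states M w = {..<M} \<times> UNIV \<times> {..<w}"

text \<open>The matrix of a query: its column at \<open>|x,g,z\<rangle>\<close> is the basis vector \<open>|x,g+A(x),z\<rangle>\<close>.\<close>

definition query_op :: "(nat \<Rightarrow> 'g::ab_group_add) \<Rightarrow> 'g basis \<Rightarrow> 'g basis \<Rightarrow> complex" where
  "query_op A b c = of_bool (b = (case c of (x, g, z) \<Rightarrow> (x, g + A x, z)))"

text \<open>
  An algorithm making \<open>q\<close> queries prepares \<open>start\<close>, applies \<open>gate 0\<close>, then alternates the \<open>k\<close>-th
  query with \<open>gate k\<close> for \<open>k = 1, \<dots>, q\<close>, and finally performs the measurement \<open>meas\<close>, whose outcome
  is its output. Nothing in the record depends on \<open>A\<close>: adaptivity is carried by the quantum state,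
  and intermediate measurements are deferred to the end using the unbounded workspace.
\<close>

record 'g query_algorithm =
  workdim :: nat
  start :: "'g basis \<Rightarrow> complex"
  gate :: "nat \<Rightarrow> 'g basis \<Rightarrow> 'g basis \<Rightarrow> complex"
  meas :: "'g \<Rightarrow> 'g basis \<Rightarrow> 'g basis \<Rightarrow> complex"

definition valid_algorithm :: "nat \<Rightarrow> nat \<Rightarrow> 'g::finite query_algorithm \<Rightarrow> bool" where
  "valid_algorithm M q alg \<longleftrightarrow>
     (let B = basis_states M (workdim alg) in
        cinner_on B (start alg) (start alg) = 1 \<and>
        (\<forall>k\<le>q. unitary_on B (gate alg k)) \<and>
        povm_on B (meas alg))"

primrec state_after ::
  "nat \<Rightarrow> 'g::ab_group_add query_algorithm \<Rightarrow> (nat \<Rightarrow> 'g) \<Rightarrow> nat \<Rightarrow> 'g basis \<Rightarrow> complex" where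
  "state_after M alg A 0 =
     apply_on (basis_states M (workdim alg)) (gate alg 0) (start alg)"
| "state_after M alg A (Suc k) =
     apply_on (basis_states M (workdim alg)) (gate alg (Suc k))
       (apply_on (basis_states M (workdim alg)) (query_op A) (state_after M alg A k))"

definition output_prob ::
  "nat \<Rightarrow> nat \<Rightarrow> 'g::ab_group_add query_algorithm \<Rightarrow> (nat \<Rightarrow> 'g) \<Rightarrow> 'g \<Rightarrow> real" where
  "output_prob M q alg A s =
     (let B = basis_states M (workdim alg); \<psi> = state_after M alg A q in
        Re (cinner_on B \<psi> (apply_on B (meas alg s) \<psi>)))"

text \<open>
  Functions \<open>{0,\<dots>,M-1} \<rightarrow> G\<close> are represented extensionally, so that each is counted exactly once.
\<close>

definition oracles :: "nat \<Rightarrow> (nat \<Rightarrow> 'g) set" where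
  "oracles M = {..<M} \<rightarrow>\<^sub>E UNIV"

definition success_prob ::
  "nat \<Rightarrow> nat \<Rightarrow> 'g::{ab_group_add,finite} query_algorithm \<Rightarrow> real" where
  "success_prob M q alg =
     (\<Sum>A\<in>oracles M. output_prob M q alg A (\<Sum>x<M. A x)) / real (card (oracles M :: (nat \<Rightarrow> 'g) set))"

definition is_max_success_prob :: "'g::{ab_group_add,finite} itself \<Rightarrow> nat \<Rightarrow> nat \<Rightarrow> real \<Rightarrow> bool" where
  "is_max_success_prob _ M q p \<longleftrightarrow>
     (\<exists>alg :: 'g query_algorithm. valid_algorithm M q alg \<and> success_prob M q alg = p) \<and>
     (\<forall>alg :: 'g query_algorithm. valid_algorithm M q alg \<longrightarrow> success_prob M q alg \<le> p)"

end

theory Submission imports Defs begin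

text \<open>
  After \<open>q\<close> queries, every amplitude is a combination of characters of \<open>G\<^sup>M\<close> that are nontrivial in at
  most \<open>q\<close> coordinates. Once the outcome is compared with the sum, two characters \<open>\<chi>\<close> and \<open>\<chi>'\<close>
  interfere only if \<open>\<chi>' = (\<chi>\<^sub>x \<eta>)\<^sub>x\<close> for a single character \<open>\<eta>\<close> of \<open>G\<close>. Such a twist has at most \<open>q\<close>
  nontrivial coordinates iff \<open>\<eta>\<^sup>-\<^sup>1\<close> occurs at least \<open>M - q\<close> times among the \<open>\<chi>\<^sub>x\<close>, so each low-weight
  character interferes with at most \<open>n = min (M div (M - q)) |G|\<close> low-weight ones (itself included), and AM-GM
  bounds the success probability by \<open>n / |G|\<close>. Conversely, choose \<open>\<chi>\<close> in which \<open>n\<close> distinct characters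
  \<open>\<eta>\<^sub>j\<close> each occur at least \<open>M - q\<close> times, and evaluate the phases \<open>\<chi> \<eta>\<^sub>j\<^sup>-\<^sup>1\<close> in superposition over \<open>j\<close> with
  \<open>q\<close> queries each; a Fourier measurement of \<open>j\<close> then finds the sum with probability \<open>n / |G|\<close>.
\<close>

subsection \<open>Characters of a finite abelian group\<close>

primrec multiple :: "nat \<Rightarrow> 'g::ab_group_add \<Rightarrow> 'g" where
  "multiple 0 y = 0"
| "multiple (Suc k) y = y + multiple k y"

lemma multiple_add: "multiple (k + l) y = multiple k y + multiple l y"
  by (induction k) (simp_all add: add.assoc)

lemma multiple_mult: "multiple (k * l) y = multiple k (multiple l y)"
  by (induction k) (simp_all add: multiple_add)

text \<open>Partial characters are pairs of a domain and a function, unconstrained off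
  \<open>H\<close>, so that domains can grow step by step. Closure under negation follows by
  finiteness.\<close>

definition char_on :: "'g::ab_group_add set \<Rightarrow> ('g \<Rightarrow> complex) \<Rightarrow> bool" where
  "char_on H \<chi> \<longleftrightarrow> 0 \<in> H \<and> \<chi> 0 = 1 \<and> (\<forall>a\<in>H. \<forall>b\<in>H. a + b \<in> H \<and> \<chi> (a + b) = \<chi> a * \<chi> b)"

definition chars :: "('g::ab_group_add \<Rightarrow> complex) set" where
  "chars = {\<chi>. char_on UNIV \<chi>}"

text \<open>Translation by \<open>a\<close> maps \<open>H\<close> injectively into itself, hence
  onto it by finiteness, so \<open>0\<close> is hit.\<close>

lemma char_on_uminus:
  fixes a :: "'g::{ab_group_add,finite}"
  assumes "char_on H \<chi>" "a \<in> H"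
  shows "- a \<in> H"
proof -
  have "(+) a ` H \<subseteq> H" using assms by (auto simp: char_on_def)
  then have "(+) a ` H = H"
    by (simp add: card_image card_subset_eq)
  then have "0 \<in> (+) a ` H" using assms(1) by (simp add: char_on_def)
  then obtain b where "b \<in> H" "a + b = 0" by auto
  then show ?thesis using minus_unique by blast
qed

lemma char_on_multiple:
  assumes "char_on H \<chi>" "a \<in> H"
  shows "multiple k a \<in> H \<and> \<chi> (multiple k a) = \<chi> a ^ k"
  using assms by (induction k) (auto simp: char_on_def)

text \<open>Pigeonhole: two multiples of \<open>y\<close> coincide, and their difference is again a
  multiple.\<close>

lemma multiple_eventually_zero:
  fixes y :: "'g::{ab_group_add,finite}"
  shows "\<exists>k>0. multiple k y = 0"
proof -
  have "\<not> inj (\<lambda>k. multiple k y)"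
    using finite_imageD[of "\<lambda>k. multiple k y" UNIV] by (auto simp: finite_subset)
  then obtain k l where "k < l" "multiple k y = multiple l y"
    by (metis injI linorder_neqE_nat)
  then have "multiple (l - k) y = 0"
    using multiple_add[of "l - k" k y] by simp
  then show ?thesis using \<open>k < l\<close> by (intro exI[of _ "l - k"]) auto
qed

lemma LEAST_multiple:
  fixes y :: "'g::{ab_group_add,finite}"
  assumes "char_on H \<chi>" "m = (LEAST k. 0 < k \<and> multiple k y \<in> H)"
  shows "0 < m" "multiple m y \<in> H"
proof -
  have "\<exists>k. 0 < k \<and> multiple k y \<in> H"
    using multiple_eventually_zero[of y] assms(1) by (auto simp: char_on_def)
  then show "0 < m" "multiple m y \<in> H"
    unfolding assms(2) using LeastI_ex by (metis (mono_tags, lifting))+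
qed

text \<open>Extension to the subgroup generated by \<open>H\<close> and \<open>y\<close>. Since
  \<open>m\<close> is the order of \<open>y\<close> modulo \<open>H\<close>, the only constraint on
  the value at \<open>y\<close> is the one at \<open>multiple m y\<close>.\<close>

lemma char_on_extend:
  fixes y :: "'g::{ab_group_add,finite}"
  assumes ch: "char_on H \<chi>"
    and m: "m = (LEAST k. 0 < k \<and> multiple k y \<in> H)"
    and \<zeta>: "\<zeta> ^ m = \<chi> (multiple m y)"
  obtains H' \<chi>' where "char_on H' \<chi>'" "H \<subseteq> H'" "y \<in> H'" "\<And>h. h \<in> H \<Longrightarrow> \<chi>' h = \<chi> h" "\<chi>' y = \<zeta>"
proof -
  have H0: "0 \<in> H" and Hadd: "\<And>a b. a \<in> H \<Longrightarrow> b \<in> H \<Longrightarrow> a + b \<in> H"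
    and \<chi>0: "\<chi> 0 = 1" and \<chi>add: "\<And>a b. a \<in> H \<Longrightarrow> b \<in> H \<Longrightarrow> \<chi> (a + b) = \<chi> a * \<chi> b"
    using ch by (auto simp: char_on_def)
  have Hdiff: "a - b \<in> H" if "a \<in> H" "b \<in> H" for a b
    using Hadd[OF that(1) char_on_uminus[OF ch that(2)]] by simp
  note mpos = LEAST_multiple(1)[OF ch m] and mH = LEAST_multiple(2)[OF ch m]
  \<comment> \<open>Division with remainder: a nonzero \<open>d mod m\<close> would undercut the
    minimal \<open>m\<close>.\<close>
  have m_dvd: "m dvd d" if "multiple d y \<in> H" for d
  proof (rule ccontr)
    assume "\<not> m dvd d"
    then have pos: "0 < d mod m" by (simp add: mod_greater_zero_iff_not_dvd)
    have "multiple d y = multiple (d div m) (multiple m y) + multiple (d mod m) y"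
      by (metis div_mult_mod_eq multiple_add multiple_mult)
    then have "multiple (d mod m) y = multiple d y - multiple (d div m) (multiple m y)" by simp
    also have "\<dots> \<in> H" using Hdiff that char_on_multiple[OF ch mH] by blast
    finally have "m \<le> d mod m" unfolding m using pos by (intro Least_le) (simp add: m)
    then show False using mod_less_divisor[OF mpos, of d] by linarith
  qed
  have pow: "\<chi> (multiple d y) = \<zeta> ^ d" if "multiple d y \<in> H" for d
  proof -
    have "m dvd d" using that by (rule m_dvd)
    then obtain t where d: "d = t * m" by (metis dvd_def mult.commute)
    have "\<zeta> ^ (t * m) = \<chi> (multiple m y) ^ t" using \<zeta> by (metis mult.commute power_mult)
    then show ?thesis using char_on_multiple[OF ch mH, of t] by (simp add: d multiple_mult)
  qed
  \<comment> \<open>Two representations of one element differ by a multiple of \<open>y\<close>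
    lying in \<open>H\<close>, where \<open>pow\<close> gives the value of \<chi>. Ordering
    \<open>k\<close> and \<open>k'\<close> keeps the subtraction of naturals exact.\<close>
  have wd_le: "\<chi> h * \<zeta> ^ k = \<chi> h' * \<zeta> ^ k'"
    if "h \<in> H" "h' \<in> H" "h + multiple k y = h' + multiple k' y" "k \<le> k'" for h h' k k'
  proof -
    define d where "d = k' - k"
    have k': "k' = d + k" using that by (simp add: d_def)
    have h: "h = h' + multiple d y" using that(3) by (simp add: k' multiple_add add.assoc[symmetric])
    then have "multiple d y = h - h'" by simp
    then have dH: "multiple d y \<in> H" using Hdiff that by simp
    show ?thesis
      unfolding h k' using \<chi>add[OF that(2) dH] pow[OF dH] by (simp add: power_add)
  qed
  then have wd: "\<chi> h * \<zeta> ^ k = \<chi> h' * \<zeta> ^ k'"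
    if "h \<in> H" "h' \<in> H" "h + multiple k y = h' + multiple k' y" for h h' k k'
    using that by (metis nle_le)
  define H' where "H' = {h + multiple k y |h k. h \<in> H}"
  \<comment> \<open>The fact \<open>wd\<close> makes the described value independent of the
    representation of \<open>z\<close>.\<close>
  define \<chi>' where "\<chi>' z = (THE c. \<exists>h k. h \<in> H \<and> z = h + multiple k y \<and> c = \<chi> h * \<zeta> ^ k)" for z
  have \<chi>': "\<chi>' (h + multiple k y) = \<chi> h * \<zeta> ^ k" if "h \<in> H" for h k
    unfolding \<chi>'_def
  proof (rule the_equality)
    fix c assume "\<exists>h' k'. h' \<in> H \<and> h + multiple k y = h' + multiple k' y \<and> c = \<chi> h' * \<zeta> ^ k'"
    then show "c = \<chi> h * \<zeta> ^ k" using wd[OF that] by metis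
  qed (use that in blast)
  have comb: "(h + multiple k y) + (h' + multiple k' y) = (h + h') + multiple (k + k') y" for h h' k k'
    by (simp add: multiple_add algebra_simps)
  have "char_on H' \<chi>'"
    unfolding char_on_def
  proof (intro conjI ballI)
    show "0 \<in> H'" unfolding H'_def using H0 by (auto intro!: exI[of _ 0])
    show "\<chi>' 0 = 1" using \<chi>'[OF H0, of 0] \<chi>0 by simp
  next
    fix a b assume "a \<in> H'" "b \<in> H'"
    then obtain h k h' k' where *: "a = h + multiple k y" "b = h' + multiple k' y" "h \<in> H" "h' \<in> H"
      by (auto simp: H'_def)
    then show "a + b \<in> H'" unfolding H'_def using comb[of h k h' k'] Hadd by blast
    show "\<chi>' (a + b) = \<chi>' a * \<chi>' b"
      unfolding * comb using * Hadd \<chi>add by (simp add: \<chi>' power_add)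
  qed
  moreover have "H \<subseteq> H'" unfolding H'_def by (force intro: exI[of _ "0::nat"])
  moreover have "y \<in> H'" unfolding H'_def using H0
    by (auto intro!: exI[of _ 0] exI[of _ "Suc 0"])
  moreover have "\<chi>' h = \<chi> h" if "h \<in> H" for h using \<chi>'[OF that, of 0] by simp
  moreover have "\<chi>' y = \<zeta>" using \<chi>'[OF H0, of 1] \<chi>0 by simp
  ultimately show ?thesis using that by blast
qed

text \<open>Start on the subgroup generated by \<open>a\<close> with a nontrivial value there, then
  enlarge the domain; a maximal domain is the whole group.\<close>

lemma chars_separate:
  fixes a :: "'g::{ab_group_add,finite}"
  assumes "a \<noteq> 0"
  obtains \<chi> where "\<chi> \<in> chars" "\<chi> a \<noteq> 1"
proof -
  let ?S = "{H. \<exists>\<chi>. char_on H \<chi> \<and> a \<in> H \<and> \<chi> a \<noteq> 1}"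
  \<comment> \<open>\<open>m\<close> is the order of \<open>a\<close>; being at least 2, it leaves a
    root of unity \<zeta> other than 1 for the value at \<open>a\<close>.\<close>
  define m where "m = (LEAST k. 0 < k \<and> multiple k a \<in> {0})"
  have triv: "char_on {0::'g} (\<lambda>_. 1)" by (simp add: char_on_def)
  have m: "0 < m" "multiple m a = 0" using LEAST_multiple[OF triv m_def] by auto
  have "m \<noteq> 1" using m assms by auto
  then have "2 \<le> m" using m by simp
  then have "1 < card {z::complex. z ^ m = 1}"
    using card_nth_roots[of 1 m] by simp
  then have "\<not> {z::complex. z ^ m = 1} \<subseteq> {1}"
    using card_mono[of "{1::complex}" "{z. z ^ m = 1}"] by auto
  then obtain \<zeta> :: complex where \<zeta>: "\<zeta> ^ m = 1" "\<zeta> \<noteq> 1" by blast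
  obtain H' \<chi>' where "char_on H' \<chi>'" "a \<in> H'" "\<chi>' a = \<zeta>"
    using char_on_extend[OF triv m_def, of \<zeta>] \<zeta>(1) by metis
  then have "H' \<in> ?S" using \<zeta> by auto
  then obtain H where H: "H \<in> ?S" and max: "\<And>H''. H'' \<in> ?S \<Longrightarrow> H \<subseteq> H'' \<Longrightarrow> H = H''"
    using finite_has_maximal[OF finite[of ?S]] by (metis (no_types, lifting) empty_iff)
  obtain \<chi> where \<chi>: "char_on H \<chi>" "a \<in> H" "\<chi> a \<noteq> 1" using H by auto
  have "y \<in> H" for y
  proof -
    define l where "l = (LEAST k. 0 < k \<and> multiple k y \<in> H)"
    note l = LEAST_multiple[OF \<chi>(1) l_def]
    \<comment> \<open>The value is invertible, with inverse the value at the negative; being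
      nonzero, it has \<open>l\<close>-th roots by \<open>card_nth_roots\<close>.\<close>
    have "\<chi> (multiple l y) \<noteq> 0"
      using \<chi>(1) l(2) char_on_uminus[OF \<chi>(1) l(2)] unfolding char_on_def
      by (metis add.right_inverse mult_zero_left zero_neq_one)
    then have "card {z. z ^ l = \<chi> (multiple l y)} \<noteq> 0"
      using l card_nth_roots by simp
    then obtain \<xi> where "\<xi> ^ l = \<chi> (multiple l y)"
      by (metis (mono_tags, lifting) Collect_empty_eq card.empty)
    then obtain H'' \<chi>'' where *: "char_on H'' \<chi>''" "H \<subseteq> H''" "y \<in> H''" "\<And>h. h \<in> H \<Longrightarrow> \<chi>'' h = \<chi> h"
      using char_on_extend[OF \<chi>(1) l_def] by metis
    then have "H'' \<in> ?S" using \<chi> by auto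
    then show ?thesis using max *(2,3) by blast
  qed
  then have "H = UNIV" by auto
  then show ?thesis using \<chi> that by (auto simp: chars_def)
qed

section \<open>Character identities and the orthogonality relations\<close>

lemma chars_0: "\<chi> \<in> chars \<Longrightarrow> \<chi> 0 = 1"
  and chars_add: "\<chi> \<in> chars \<Longrightarrow> \<chi> (a + b) = \<chi> a * \<chi> b"
  by (simp_all add: chars_def char_on_def)

lemma chars_one: "(\<lambda>_. 1) \<in> chars"
  and chars_mult: "\<chi> \<in> chars \<Longrightarrow> \<eta> \<in> chars \<Longrightarrow> (\<lambda>g. \<chi> g * \<eta> g) \<in> chars"
  and chars_cnj: "\<chi> \<in> chars \<Longrightarrow> (\<lambda>g. cnj (\<chi> g)) \<in> chars"
  by (auto simp: chars_def char_on_def)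

lemma chars_torsion:
  fixes \<chi> :: "'g::{ab_group_add,finite} \<Rightarrow> complex"
  assumes "\<chi> \<in> chars"
  shows "\<exists>k>0. \<chi> g ^ k = 1"
proof -
  obtain k where "0 < k" "multiple k g = 0" using multiple_eventually_zero by blast
  then show ?thesis
    using char_on_multiple[of UNIV \<chi> g k] assms by (intro exI[of _ k]) (simp add: chars_def char_on_def)
qed

lemma chars_norm:
  fixes \<chi> :: "'g::{ab_group_add,finite} \<Rightarrow> complex"
  assumes "\<chi> \<in> chars"
  shows "cmod (\<chi> g) = 1"
  using chars_torsion[OF assms, of g] 
  by (metis norm_power norm_one norm_ge_zero power_eq_1_iff neq0_conv)

lemma chars_mult_cnj:
  fixes \<chi> :: "'g::{ab_group_add,finite} \<Rightarrow> complex"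
  assumes "\<chi> \<in> chars"
  shows "\<chi> g * cnj (\<chi> g) = 1" "cnj (\<chi> g) * \<chi> g = 1"
  using chars_norm[OF assms, of g] by (simp_all add: complex_norm_square[symmetric] mult.commute)

lemma chars_uminus:
  fixes \<chi> :: "'g::{ab_group_add,finite} \<Rightarrow> complex"
  assumes "\<chi> \<in> chars"
  shows "\<chi> (- g) = cnj (\<chi> g)"
proof -
  have "\<chi> (- g) = \<chi> (- g) * (\<chi> g * cnj (\<chi> g))" using chars_mult_cnj(1)[OF assms] by simp
  also have "\<dots> = \<chi> (- g + g) * cnj (\<chi> g)" unfolding chars_add[OF assms] by simp
  finally show ?thesis by (simp add: chars_0[OF assms])
qed

lemma chars_sum: "\<chi> \<in> chars \<Longrightarrow> \<chi> (\<Sum>x\<in>X. f x) = (\<Prod>x\<in>X. \<chi> (f x))"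
  by (induction X rule: infinite_finite_induct) (simp_all add: chars_0 chars_add)

text \<open>Shifting the summation variable by some \<open>a\<close> with \<chi> a \<noteq> 1
  multiplies the sum by \<chi> a, so it vanishes.\<close>

lemma sum_char:
  fixes \<chi> :: "'g::{ab_group_add,finite} \<Rightarrow> complex"
  assumes "\<chi> \<in> chars"
  shows "(\<Sum>g\<in>UNIV. \<chi> g) = of_bool (\<chi> = (\<lambda>_. 1)) * of_nat CARD('g)"
proof (cases "\<chi> = (\<lambda>_. 1)")
  case False
  then obtain a where a: "\<chi> a \<noteq> 1" by auto
  have "(\<Sum>g\<in>UNIV. \<chi> g) = (\<Sum>g\<in>UNIV. \<chi> (a + g))"
    by (rule sum.reindex_bij_witness[of _ "\<lambda>g. a + g" "\<lambda>g. - a + g"]) auto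
  also have "\<dots> = \<chi> a * (\<Sum>g\<in>UNIV. \<chi> g)" by (simp add: chars_add[OF assms] sum_distrib_left)
  finally show ?thesis using a False by simp
qed simp

lemma finite_chars: "finite (chars :: ('g::{ab_group_add,finite} \<Rightarrow> complex) set)"
proof -
  obtain k :: "'g \<Rightarrow> nat" where k: "\<And>g. 0 < k g \<and> multiple (k g) g = 0"
    using multiple_eventually_zero by metis
  have "chars \<subseteq> PiE UNIV (\<lambda>g::'g. {z. z ^ k g = 1})"
  proof (intro subsetI PiE_I CollectI)
    fix \<chi> g assume "\<chi> \<in> (chars :: ('g \<Rightarrow> complex) set)"
    then show "\<chi> g ^ k g = 1"
      using char_on_multiple[of UNIV \<chi> g "k g"] k[of g] by (simp add: chars_def char_on_def)
  qed simp
  moreover have "finite \<dots>" using k by (intro finite_PiE) (auto intro: finite_roots_unity)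
  ultimately show ?thesis by (rule finite_subset)
qed

text \<open>Dual orthogonality. The number of characters stays an unknown here, since
  \<open>card_chars\<close> is deduced from this.\<close>

lemma sum_chars_aux:
  fixes a :: "'g::{ab_group_add,finite}"
  shows "(\<Sum>\<chi>\<in>chars. \<chi> a) = of_bool (a = 0) * of_nat (card (chars :: ('g \<Rightarrow> complex) set))"
proof (cases "a = 0")
  case False
  then obtain \<psi> where \<psi>: "\<psi> \<in> chars" "\<psi> a \<noteq> 1" using chars_separate by blast
  \<comment> \<open>Multiplication by \<psi> permutes the characters; its inverse is multiplication
    by the conjugate.\<close>
  have "(\<Sum>\<chi>\<in>chars. \<chi> a) = (\<Sum>\<chi>\<in>chars. \<psi> a * \<chi> a)"
    by (rule sum.reindex_bij_witness[of _ "\<lambda>\<chi> g. \<psi> g * \<chi> g" "\<lambda>\<chi> g. cnj (\<psi> g) * \<chi> g"])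
      (use \<psi>(1) in \<open>auto simp: chars_mult chars_cnj mult.assoc[symmetric] chars_mult_cnj\<close>)
  also have "\<dots> = \<psi> a * (\<Sum>\<chi>\<in>chars. \<chi> a)" by (simp add: sum_distrib_left)
  finally show ?thesis using \<psi> False by simp
qed (simp add: chars_0)

text \<open>Double counting of all values \<chi> g: summing over \<open>g\<close> first leaves only
  the trivial character, summing over \<chi> first only \<open>g = 0\<close>.\<close>

lemma card_chars: "card (chars :: ('g::{ab_group_add,finite} \<Rightarrow> complex) set) = CARD('g)"
proof -
  let ?C = "chars :: ('g \<Rightarrow> complex) set"
  have "(\<Sum>\<chi>\<in>?C. \<Sum>g\<in>UNIV. \<chi> g) = (\<Sum>\<chi>\<in>?C. of_bool (\<chi> = (\<lambda>_. 1)) * of_nat CARD('g))"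
    by (intro sum.cong refl sum_char)
  also have "\<dots> = of_nat CARD('g)"
    using finite_chars chars_one by (subst sum.remove[of _ "\<lambda>_. 1"]) auto
  finally have "of_nat CARD('g) = (\<Sum>g\<in>UNIV. \<Sum>\<chi>\<in>?C. \<chi> g)"
    by (subst sum.swap) simp
  also have "\<dots> = (\<Sum>g\<in>(UNIV::'g set). of_bool (g = 0) * of_nat (card ?C))"
    by (intro sum.cong refl sum_chars_aux)
  also have "\<dots> = of_nat (card ?C)"
    by (subst sum.remove[of _ 0]) auto
  finally show ?thesis by simp
qed

lemma sum_chars:
  fixes a b :: "'g::{ab_group_add,finite}"
  shows "(\<Sum>\<chi>\<in>chars. \<chi> a * cnj (\<chi> b)) = of_bool (a = b) * of_nat CARD('g)"
proof -
  have "(\<Sum>\<chi>\<in>chars. \<chi> a * cnj (\<chi> b)) = (\<Sum>\<chi>\<in>chars. \<chi> (a - b))"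
    by (intro sum.cong refl) (simp add: chars_uminus[symmetric] chars_add[symmetric])
  then show ?thesis by (simp add: sum_chars_aux card_chars)
qed

lemma chars_orthogonal:
  fixes \<chi> \<eta> :: "'g::{ab_group_add,finite} \<Rightarrow> complex"
  assumes "\<chi> \<in> chars" "\<eta> \<in> chars"
  shows "(\<Sum>g\<in>UNIV. cnj (\<chi> g) * \<eta> g) = of_bool (\<chi> = \<eta>) * of_nat CARD('g)"
proof -
  have "(\<lambda>g. cnj (\<chi> g) * \<eta> g) = (\<lambda>_. 1) \<longleftrightarrow> \<chi> = \<eta>"
  proof
    assume "(\<lambda>g. cnj (\<chi> g) * \<eta> g) = (\<lambda>_. 1)"
    then have "cnj (\<chi> g) * \<eta> g = 1" for g by meson
    then have "\<chi> g * (cnj (\<chi> g) * \<eta> g) = \<chi> g" for g by simp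
    then show "\<chi> = \<eta>" by (auto simp: mult.assoc[symmetric] chars_mult_cnj[OF assms(1)])
  qed (simp add: chars_mult_cnj assms)
  then show ?thesis using sum_char[OF chars_mult[OF chars_cnj[OF assms(1)] assms(2)]] by simp
qed

subsection \<open>Measurements and unitarity\<close>

lemma sum_of_bool_eq:
  fixes f :: "'a \<Rightarrow> 'b::semiring_1"
  assumes "finite B" "i \<in> B"
  shows "(\<Sum>j\<in>B. of_bool (i = j) * f j) = f i"
proof -
  have "(\<Sum>j\<in>B. of_bool (i = j) * f j) = (\<Sum>j\<in>B. if i = j then f j else 0)"
    by (intro sum.cong) auto
  then show ?thesis using assms by simp
qed

lemma cinner_apply:
  "cinner_on B u (apply_on B E v) = (\<Sum>i\<in>B. \<Sum>j\<in>B. E i j * (cnj (u i) * v j))"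
  by (simp add: cinner_on_def apply_on_def sum_distrib_left mult_ac)

text \<open>AM-GM for the form: expand its nonnegative value at \<open>u - c v\<close>, where
  \<open>c\<close> has modulus one.\<close>

lemma psd_cross:
  assumes "psd_on B E" "cmod c = 1"
  shows "Re (c * cinner_on B u (apply_on B E v)) + Re (cnj c * cinner_on B v (apply_on B E u))
    \<le> Re (cinner_on B u (apply_on B E u)) + Re (cinner_on B v (apply_on B E v))"
proof -
  let ?Q = "\<lambda>u v. cinner_on B u (apply_on B E v)"
  let ?w = "\<lambda>i. u i - c * v i"
  have c: "cnj c * c = 1" using assms(2) by (simp add: complex_norm_square[symmetric] mult.commute)
  have "?Q ?w ?w = (\<Sum>i\<in>B. \<Sum>j\<in>B. E i j * (cnj (u i) * u j) - c * (E i j * (cnj (u i) * v j))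
      - cnj c * (E i j * (cnj (v i) * u j)) + (cnj c * c) * (E i j * (cnj (v i) * v j)))"
    unfolding cinner_apply by (intro sum.cong refl) (simp add: algebra_simps)
  also have "\<dots> = ?Q u u - c * ?Q u v - cnj c * ?Q v u + ?Q v v"
    unfolding c by (simp add: cinner_apply sum.distrib sum_subtractf sum_distrib_left)
  finally have "Re (?Q ?w ?w) = Re (?Q u u - c * ?Q u v - cnj c * ?Q v u + ?Q v v)" by simp
  moreover have "0 \<le> Re (?Q ?w ?w)" using assms(1) by (simp add: psd_on_def)
  ultimately show ?thesis by simp
qed

lemma povm_sum:
  assumes "povm_on B E" "finite B"
  shows "(\<Sum>g\<in>UNIV. cinner_on B u (apply_on B (E g) u)) = cinner_on B u u"
proof -
  have "(\<Sum>g\<in>UNIV. cinner_on B u (apply_on B (E g) u))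
      = (\<Sum>i\<in>B. \<Sum>j\<in>B. (\<Sum>g\<in>UNIV. E g i j) * (cnj (u i) * u j))"
    unfolding cinner_apply
    by (subst sum.swap, intro sum.cong refl, subst sum.swap) (simp add: sum_distrib_right)
  also have "\<dots> = (\<Sum>i\<in>B. \<Sum>j\<in>B. of_bool (i = j) * (cnj (u i) * u j))"
    using assms(1) by (intro sum.cong refl) (simp add: povm_on_def)
  also have "\<dots> = cinner_on B u u"
    unfolding cinner_on_def using assms(2)
    by (intro sum.cong refl sum_of_bool_eq)
  finally show ?thesis .
qed

lemma cinner_unitary:
  assumes "unitary_on B U" "finite B"
  shows "cinner_on B (apply_on B U v) (apply_on B U v) = cinner_on B v v"
proof -
  have "cinner_on B (apply_on B U v) (apply_on B U v)
      = (\<Sum>k\<in>B. \<Sum>i\<in>B. \<Sum>j\<in>B. cnj (U k i) * U k j * (cnj (v i) * v j))"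
    unfolding cinner_on_def apply_on_def
    by (simp only: cnj_sum sum_product complex_cnj_mult) (simp add: mult_ac)
  also have "\<dots> = (\<Sum>i\<in>B. \<Sum>j\<in>B. (\<Sum>k\<in>B. cnj (U k i) * U k j) * (cnj (v i) * v j))"
    by (subst sum.swap, rule sum.cong[OF refl], subst sum.swap) (simp add: sum_distrib_right)
  also have "\<dots> = (\<Sum>i\<in>B. \<Sum>j\<in>B. of_bool (i = j) * (cnj (v i) * v j))"
    using assms(1) by (intro sum.cong refl) (simp add: unitary_on_def)
  also have "\<dots> = cinner_on B v v"
    unfolding cinner_on_def using assms(2)
    by (intro sum.cong refl sum_of_bool_eq)
  finally show ?thesis .
qed

section \<open>Action of queries and normalisation of the states\<close>

lemma finite_basis_states: "finite (basis_states M w :: 'g::finite basis set)"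
  by (simp add: basis_states_def)

text \<open>The only column with a nonzero entry in this row is
  \<open>(x, g - A x, z)\<close>.\<close>

lemma apply_query:
  fixes g :: "'g::{ab_group_add,finite}"
  assumes "(x, g, z) \<in> basis_states M w"
  shows "apply_on (basis_states M w) (query_op A) v (x, g, z) = v (x, g - A x, z)"
proof -
  have "apply_on (basis_states M w) (query_op A) v (x, g, z)
      = (\<Sum>j\<in>basis_states M w. if j = (x, g - A x, z) then v j else 0)"
    unfolding apply_on_def query_op_def by (intro sum.cong refl) auto
  then show ?thesis using assms by (simp add: finite_basis_states) (simp add: basis_states_def)
qed

lemma cinner_query:
  fixes M w :: nat and v :: "'g::{ab_group_add,finite} basis \<Rightarrow> complex"
  defines "B \<equiv> basis_states M w"
  shows "cinner_on B (apply_on B (query_op A) v) (apply_on B (query_op A) v) = cinner_on B v v"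
  unfolding cinner_on_def
proof (rule sum.reindex_bij_witness[of _ "\<lambda>(x, g, z). (x, g + A x, z)" "\<lambda>(x, g, z). (x, g - A x, z)"])
  fix b assume "b \<in> B"
  then show "cnj (v (case b of (x, g, z) \<Rightarrow> (x, g - A x, z))) * v (case b of (x, g, z) \<Rightarrow> (x, g - A x, z))
      = cnj (apply_on B (query_op A) v b) * apply_on B (query_op A) v b"
    unfolding B_def by (cases b) (simp add: apply_query)
qed (auto simp: B_def basis_states_def)

lemma cinner_state:
  fixes alg :: "'g::{ab_group_add,finite} query_algorithm"
  assumes "valid_algorithm M q alg" "k \<le> q"
  defines "B \<equiv> basis_states M (workdim alg)"
  shows "cinner_on B (state_after M alg A k) (state_after M alg A k) = 1"
  using assms(2)
proof (induction k)
  case 0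
  then show ?case
    using assms(1) by (simp add: valid_algorithm_def Let_def cinner_unitary finite_basis_states B_def)
next
  case (Suc k)
  then show ?case
    using assms(1)
    by (simp add: cinner_query valid_algorithm_def Let_def cinner_unitary finite_basis_states B_def)
qed

subsection \<open>Fourier analysis on oracles\<close>

text \<open>The character of the group \<open>G^M\<close> with components
  \<open>\<chi> x\<close>.\<close>

definition pchar :: "nat \<Rightarrow> (nat \<Rightarrow> 'g \<Rightarrow> complex) \<Rightarrow> (nat \<Rightarrow> 'g) \<Rightarrow> complex" where
  "pchar M \<chi> A = (\<Prod>x<M. \<chi> x (A x))"

definition mchars :: "nat \<Rightarrow> (nat \<Rightarrow> 'g::ab_group_add \<Rightarrow> complex) set" where
  "mchars M = {..<M} \<rightarrow>\<^sub>E chars"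

text \<open>Unnormalised, hence the power of \<open>CARD('g)\<close> in
  \<open>plancherel\<close>.\<close>

definition fourier ::
  "nat \<Rightarrow> ((nat \<Rightarrow> 'g) \<Rightarrow> complex) \<Rightarrow> (nat \<Rightarrow> 'g \<Rightarrow> complex) \<Rightarrow> complex" where
  "fourier M f \<chi> = (\<Sum>A\<in>oracles M. cnj (pchar M \<chi> A) * f A)"

definition weight :: "nat \<Rightarrow> (nat \<Rightarrow> 'g \<Rightarrow> complex) \<Rightarrow> nat" where
  "weight M \<chi> = card {x \<in> {..<M}. \<chi> x \<noteq> (\<lambda>_. 1)}"

text \<open>The analogue of being a polynomial of degree at most \<open>k\<close>.\<close>

definition lowdeg :: "nat \<Rightarrow> nat \<Rightarrow> ((nat \<Rightarrow> 'g::ab_group_add) \<Rightarrow> complex) \<Rightarrow> bool" where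
  "lowdeg M k f \<longleftrightarrow> (\<forall>\<chi>\<in>mchars M. k < weight M \<chi> \<longrightarrow> fourier M f \<chi> = 0)"

text \<open>Product with the character of \<open>G^M\<close> sending \<open>A\<close> to \<eta> of
  the sum of its values. The restriction to \<open>{..<M}\<close> keeps the tuple
  extensional.\<close>

definition twist :: "nat \<Rightarrow> (nat \<Rightarrow> 'g \<Rightarrow> complex) \<Rightarrow> ('g \<Rightarrow> complex) \<Rightarrow> nat \<Rightarrow> 'g \<Rightarrow> complex" where
  "twist M \<chi> \<eta> = (\<lambda>x\<in>{..<M}. \<lambda>g. \<chi> x g * \<eta> g)"

lemma finite_oracles: "finite (oracles M :: (nat \<Rightarrow> 'g::finite) set)"
  by (simp add: oracles_def finite_PiE)

lemma card_oracles: "card (oracles M :: (nat \<Rightarrow> 'g::finite) set) = CARD('g) ^ M"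
  by (simp add: oracles_def card_PiE)

text \<open>The sum over tuples factors into one-coordinate sums, where \<open>sum_chars\<close>
  applies.\<close>

lemma sum_pchar:
  fixes A B :: "nat \<Rightarrow> 'g::{ab_group_add,finite}"
  assumes "A \<in> oracles M" "B \<in> oracles M"
  shows "(\<Sum>\<chi>\<in>mchars M. pchar M \<chi> A * cnj (pchar M \<chi> B)) = of_bool (A = B) * of_nat CARD('g) ^ M"
proof -
  have "(\<Sum>\<chi>\<in>mchars M. pchar M \<chi> A * cnj (pchar M \<chi> B))
      = (\<Sum>\<chi>\<in>mchars M. \<Prod>x<M. \<chi> x (A x) * cnj (\<chi> x (B x)))"
    by (simp add: pchar_def prod.distrib)
  also have "\<dots> = (\<Prod>x<M. \<Sum>\<eta>\<in>chars. \<eta> (A x) * cnj (\<eta> (B x)))"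
    unfolding mchars_def
    by (subst prod_sum_PiE) (simp_all add: finite_chars)
  also have "\<dots> = (\<Prod>x<M. of_bool (A x = B x)) * of_nat CARD('g) ^ M"
    by (simp add: sum_chars prod.distrib)
  also have "(\<Prod>x<M. of_bool (A x = B x) :: complex) = of_bool (A = B)"
  proof (cases "A = B")
    case False
    then obtain x where "x < M" "A x \<noteq> B x"
      using assms PiE_ext[of A "{..<M}" "\<lambda>_. UNIV" B] by (auto simp: oracles_def)
    then show ?thesis using False by (auto simp: prod_zero_iff)
  qed simp
  finally show ?thesis .
qed

lemma plancherel:
  fixes f h :: "(nat \<Rightarrow> 'g::{ab_group_add,finite}) \<Rightarrow> complex"
  shows "(\<Sum>\<chi>\<in>mchars M. cnj (fourier M f \<chi>) * fourier M h \<chi>)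
    = of_nat CARD('g) ^ M * (\<Sum>A\<in>oracles M. cnj (f A) * h A)"
proof -
  let ?O = "oracles M :: (nat \<Rightarrow> 'g) set"
  have "(\<Sum>\<chi>\<in>mchars M. cnj (fourier M f \<chi>) * fourier M h \<chi>)
      = (\<Sum>\<chi>\<in>mchars M. \<Sum>A\<in>?O. \<Sum>B\<in>?O. (pchar M \<chi> A * cnj (pchar M \<chi> B)) * (cnj (f A) * h B))"
    unfolding fourier_def
    by (simp only: cnj_sum sum_product complex_cnj_mult complex_cnj_cnj) (simp add: mult_ac)
  also have "\<dots> = (\<Sum>A\<in>?O. \<Sum>B\<in>?O. (\<Sum>\<chi>\<in>mchars M. pchar M \<chi> A * cnj (pchar M \<chi> B)) * (cnj (f A) * h B))"
    by (subst sum.swap, intro sum.cong refl, subst sum.swap) (simp add: sum_distrib_right)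
  also have "\<dots> = (\<Sum>A\<in>?O. \<Sum>B\<in>?O. if A = B then of_nat CARD('g) ^ M * (cnj (f A) * h B) else 0)"
    by (intro sum.cong refl) (simp add: sum_pchar)
  also have "\<dots> = of_nat CARD('g) ^ M * (\<Sum>A\<in>?O. cnj (f A) * h A)"
    by (simp add: finite_oracles sum_distrib_left)
  finally show ?thesis .
qed

section \<open>Twists by characters of the sum\<close>

lemma twist_mchars: "\<chi> \<in> mchars M \<Longrightarrow> \<eta> \<in> chars \<Longrightarrow> twist M \<chi> \<eta> \<in> mchars M"
  unfolding mchars_def twist_def by (auto intro!: chars_mult)

lemma twist_twist_cnj:
  fixes \<chi> :: "nat \<Rightarrow> 'g::{ab_group_add,finite} \<Rightarrow> complex"
  assumes "\<chi> \<in> mchars M" "\<eta> \<in> chars"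
  shows "twist M (twist M \<chi> (\<lambda>g. cnj (\<eta> g))) \<eta> = \<chi>"
proof
  fix x
  show "twist M (twist M \<chi> (\<lambda>g. cnj (\<eta> g))) \<eta> x = \<chi> x"
    using assms by (cases "x < M")
      (auto simp: twist_def mchars_def mult.assoc chars_mult_cnj intro: PiE_arb[symmetric])
qed

lemma pchar_twist:
  assumes "\<eta> \<in> chars"
  shows "pchar M (twist M \<chi> \<eta>) A = pchar M \<chi> A * \<eta> (\<Sum>x<M. A x)"
  by (simp add: pchar_def twist_def prod.distrib chars_sum[OF assms])

text \<open>A character of the sum moves coefficients along twists; this is how comparing the
  outcome with the sum produces interference.\<close>

lemma fourier_mult_char:
  assumes "\<eta> \<in> chars"
  shows "fourier M (\<lambda>A. \<eta> (\<Sum>x<M. A x) * f A) \<chi> = fourier M f (twist M \<chi> (\<lambda>g. cnj (\<eta> g)))"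
  by (simp add: fourier_def pchar_twist[OF chars_cnj[OF assms]] mult_ac)

section \<open>Low Fourier degree of the amplitudes\<close>

lemma lowdeg_sum:
  assumes "\<And>i. i \<in> I \<Longrightarrow> lowdeg M k (f i)"
  shows "lowdeg M k (\<lambda>A. \<Sum>i\<in>I. c i * f i A)"
proof -
  have "fourier M (\<lambda>A. \<Sum>i\<in>I. c i * f i A) \<chi> = (\<Sum>i\<in>I. c i * fourier M (f i) \<chi>)" for \<chi>
    unfolding fourier_def by (simp add: sum_distrib_left mult_ac) (rule sum.swap)
  then show ?thesis using assms by (simp add: lowdeg_def)
qed

text \<open>The coefficient factors over the coordinates, and a nontrivial coordinate contributes a
  vanishing character sum.\<close>

lemma lowdeg_const: "lowdeg M 0 (\<lambda>A :: nat \<Rightarrow> 'g::{ab_group_add,finite}. c)"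
  unfolding lowdeg_def
proof (intro ballI impI)
  fix \<chi> :: "nat \<Rightarrow> 'g \<Rightarrow> complex" assume \<chi>: "\<chi> \<in> mchars M" "0 < weight M \<chi>"
  then obtain y where y: "y < M" "\<chi> y \<noteq> (\<lambda>_. 1)" by (auto simp: weight_def card_gt_0_iff)
  have "fourier M (\<lambda>A. c) \<chi> = cnj (\<Sum>A\<in>oracles M. \<Prod>x<M. \<chi> x (A x)) * c"
    by (simp add: fourier_def pchar_def sum_distrib_right)
  also have "(\<Sum>A\<in>oracles M. \<Prod>x<M. \<chi> x (A x)) = (\<Prod>x<M. \<Sum>g\<in>UNIV. \<chi> x g)"
    unfolding oracles_def by (subst prod_sum_PiE) simp_all
  also have "\<dots> = 0"
    using y \<chi>(1) sum_char[of "\<chi> y"] by (auto simp: prod_zero_iff mchars_def intro!: bexI[of _ y])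
  finally show "fourier M (\<lambda>A. c) \<chi> = 0" by simp
qed

text \<open>The indicator of \<open>A x = t\<close> is a combination of characters in coordinate
  \<open>x\<close> alone, so multiplying by it changes weights by at most one.\<close>

lemma lowdeg_point:
  fixes f :: "(nat \<Rightarrow> 'g::{ab_group_add,finite}) \<Rightarrow> complex"
  assumes "lowdeg M k f" "x < M"
  shows "lowdeg M (Suc k) (\<lambda>A. of_bool (A x = t) * f A)"
  unfolding lowdeg_def
proof (intro ballI impI)
  fix \<chi> :: "nat \<Rightarrow> 'g \<Rightarrow> complex" assume \<chi>: "\<chi> \<in> mchars M" "Suc k < weight M \<chi>"
  let ?\<chi> = "\<lambda>\<eta>. \<chi>(x := (\<lambda>g. \<chi> x g * \<eta> g))"
  have pc: "pchar M (?\<chi> \<eta>) A = pchar M \<chi> A * \<eta> (A x)" for \<eta> A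
  proof -
    have "pchar M (?\<chi> \<eta>) A = (\<Prod>y<M. \<chi> y (A y) * (if y = x then \<eta> (A y) else 1))"
      unfolding pchar_def by (intro prod.cong) auto
    then show ?thesis using \<open>x < M\<close> by (simp add: prod.distrib pchar_def)
  qed
  have zero: "fourier M f (?\<chi> \<eta>) = 0" if "\<eta> \<in> chars" for \<eta>
  proof -
    have "?\<chi> \<eta> \<in> mchars M" using \<chi>(1) that \<open>x < M\<close> by (auto simp: mchars_def PiE_iff chars_mult extensional_def)
    moreover have "weight M \<chi> \<le> Suc (weight M (?\<chi> \<eta>))"
    proof -
      have "{y \<in> {..<M}. \<chi> y \<noteq> (\<lambda>_. 1)} \<subseteq> insert x {y \<in> {..<M}. ?\<chi> \<eta> y \<noteq> (\<lambda>_. 1)}" by auto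
      then have "weight M \<chi> \<le> card (insert x {y \<in> {..<M}. ?\<chi> \<eta> y \<noteq> (\<lambda>_. 1)})"
        unfolding weight_def by (intro card_mono) auto
      also have "\<dots> \<le> Suc (weight M (?\<chi> \<eta>))" unfolding weight_def by (intro card_insert_le_m1) auto
      finally show ?thesis .
    qed
    ultimately show ?thesis using assms(1) \<chi>(2) by (simp add: lowdeg_def)
  qed
  \<comment> \<open>Character expansion of the indicator; each character is absorbed into coordinate
    \<open>x\<close> of \<chi>.\<close>
  have "of_nat CARD('g) * fourier M (\<lambda>A. of_bool (A x = t) * f A) \<chi>
      = (\<Sum>A\<in>oracles M. (\<Sum>\<eta>\<in>chars. \<eta> t * cnj (\<eta> (A x))) * (cnj (pchar M \<chi> A) * f A))"
    unfolding sum_chars fourier_def sum_distrib_left by (intro sum.cong refl) auto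
  also have "\<dots> = (\<Sum>\<eta>\<in>chars. \<eta> t * fourier M f (?\<chi> \<eta>))"
    unfolding fourier_def pc sum_distrib_right sum_distrib_left
    by (subst sum.swap) (simp add: mult_ac)
  also have "\<dots> = 0" using zero by simp
  finally show "fourier M (\<lambda>A. of_bool (A x = t) * f A) \<chi> = 0" by simp
qed

text \<open>Gates combine amplitudes with coefficients free of \<open>A\<close>; only queries raise
  the degree, each by at most one.\<close>

lemma lowdeg_state:
  fixes alg :: "'g::{ab_group_add,finite} query_algorithm"
  shows "lowdeg M k (\<lambda>A. state_after M alg A k b)"
proof (induction k arbitrary: b)
  case 0
  show ?case using lowdeg_const by simp
next
  case (Suc k)
  let ?B = "basis_states M (workdim alg) :: 'g basis set"
  have *: "lowdeg M (Suc k) (\<lambda>A. apply_on ?B (query_op A) (state_after M alg A k) b)" if b: "b \<in> ?B" for b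
  proof -
    obtain x g z where xgz: "b = (x, g, z)" by (metis prod_cases3)
    \<comment> \<open>The amplitude comes from the previous response \<open>h\<close> with
      \<open>A x = g - h\<close>; the coefficient \<open>1\<close> gives the sum the shape of
      \<open>lowdeg_sum\<close>.\<close>
    have "apply_on ?B (query_op A) (state_after M alg A k) b
        = (\<Sum>h\<in>UNIV. 1 * (of_bool (A x = g - h) * state_after M alg A k (x, h, z)))" for A
    proof -
      have "(\<Sum>h\<in>UNIV. 1 * (of_bool (A x = g - h) * state_after M alg A k (x, h, z)))
          = (\<Sum>h\<in>UNIV. if h = g - A x then state_after M alg A k (x, h, z) else 0)"
        by (intro sum.cong refl) (auto simp: algebra_simps)
      then show ?thesis using apply_query b xgz by simp
    qed
    moreover have "lowdeg M (Suc k) (\<lambda>A. \<Sum>h\<in>UNIV. 1 * (of_bool (A x = g - h) * state_after M alg A k (x, h, z)))"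
      using b xgz by (intro lowdeg_sum lowdeg_point Suc.IH) (simp add: basis_states_def)
    ultimately show ?thesis by presburger
  qed
  show ?case
    using lowdeg_sum[of ?B M "Suc k" "\<lambda>b A. apply_on ?B (query_op A) (state_after M alg A k) b"] *
    by (simp add: apply_on_def[of _ "gate _ _"])
qed

subsection \<open>The upper bound\<close>

text \<open>Each admissible \<eta> is the value of \<chi> at no fewer than \<open>M - q\<close>
  positions, and different \<eta> occupy disjoint sets of positions.\<close>

lemma card_twists:
  fixes \<chi> :: "nat \<Rightarrow> 'g::{ab_group_add,finite} \<Rightarrow> complex"
  assumes \<chi>: "\<chi> \<in> mchars M" and q: "q < M"
  shows "card {\<eta> \<in> chars. weight M (twist M \<chi> (\<lambda>g. cnj (\<eta> g))) \<le> q} \<le> min (M div (M - q)) CARD('g)"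
proof -
  let ?K = "{\<eta> \<in> chars. weight M (twist M \<chi> (\<lambda>g. cnj (\<eta> g))) \<le> q}"
  have fin: "finite ?K" by (simp add: finite_chars)
  have tw: "twist M \<chi> (\<lambda>g. cnj (\<eta> g)) x = (\<lambda>_. 1) \<longleftrightarrow> \<chi> x = \<eta>" if "x < M" "\<eta> \<in> chars" for x \<eta>
  proof
    assume "twist M \<chi> (\<lambda>g. cnj (\<eta> g)) x = (\<lambda>_. 1)"
    then have *: "\<chi> x g * cnj (\<eta> g) = 1" for g using that by (simp add: twist_def) meson
    show "\<chi> x = \<eta>"
    proof
      fix g
      have "\<chi> x g = \<chi> x g * (cnj (\<eta> g) * \<eta> g)" using chars_mult_cnj[OF that(2)] by simp
      then show "\<chi> x g = \<eta> g" using *[of g] by (simp add: mult.assoc[symmetric])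
    qed
  qed (use that chars_mult_cnj in \<open>auto simp: twist_def\<close>)
  have large: "M - q \<le> card {x \<in> {..<M}. \<chi> x = \<eta>}" if "\<eta> \<in> ?K" for \<eta>
  proof -
    have "{x \<in> {..<M}. \<chi> x = \<eta>} = {..<M} - {x \<in> {..<M}. twist M \<chi> (\<lambda>g. cnj (\<eta> g)) x \<noteq> (\<lambda>_. 1)}"
      using tw that by auto
    then have "card {x \<in> {..<M}. \<chi> x = \<eta>} = M - weight M (twist M \<chi> (\<lambda>g. cnj (\<eta> g)))"
      unfolding weight_def by (simp only: card_Diff_subset) (subst card_Diff_subset, auto)
    then show ?thesis using that by auto
  qed
  have "card ?K * (M - q) \<le> (\<Sum>\<eta>\<in>?K. card {x \<in> {..<M}. \<chi> x = \<eta>})"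
    using sum_bounded_below[of ?K "M - q"] large by simp
  also have "\<dots> = card (\<Union>\<eta>\<in>?K. {x \<in> {..<M}. \<chi> x = \<eta>})"
    using fin by (intro card_UN_disjoint[symmetric]) auto
  also have "\<dots> \<le> card {..<M}" by (intro card_mono) auto
  finally have "card ?K \<le> M div (M - q)"
    using q by (simp add: less_eq_div_iff_mult_less_eq)
  moreover have "card ?K \<le> CARD('g)"
    unfolding card_chars[symmetric] by (intro card_mono finite_chars) auto
  ultimately show ?thesis by simp
qed

text \<open>The indicator is expanded in characters of the sum, which costs the extra factor in
  \<open>Suc M\<close>; Plancherel then turns each of them into a twist.\<close>

lemma outcome_fourier:
  fixes M :: nat and \<psi> :: "(nat \<Rightarrow> 'g::{ab_group_add,finite}) \<Rightarrow> 'b \<Rightarrow> complex"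
  defines "F \<equiv> \<lambda>\<chi> b. fourier M (\<lambda>A. \<psi> A b) \<chi>"
  shows "of_nat CARD('g) ^ Suc M
      * (\<Sum>A\<in>oracles M. of_bool ((\<Sum>x<M. A x) = g) * cinner_on B (\<psi> A) (apply_on B E (\<psi> A)))
    = (\<Sum>(\<chi>, \<eta>)\<in>mchars M \<times> chars.
        cnj (\<eta> g) * cinner_on B (F \<chi>) (apply_on B E (F (twist M \<chi> (\<lambda>g. cnj (\<eta> g))))))"
proof -
  let ?N = "of_nat CARD('g) :: complex"
  let ?Q = "\<lambda>u v. cinner_on B u (apply_on B E v)"
  let ?O = "oracles M :: (nat \<Rightarrow> 'g) set"
  have pl: "?N ^ M * (\<Sum>A\<in>?O. \<eta> (\<Sum>x<M. A x) * ?Q (\<psi> A) (\<psi> A))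
      = (\<Sum>\<chi>\<in>mchars M. ?Q (F \<chi>) (F (twist M \<chi> (\<lambda>g. cnj (\<eta> g)))))" if "\<eta> \<in> chars" for \<eta>
  proof -
    have pw: "?N ^ M * (\<Sum>A\<in>?O. cnj (\<psi> A i) * (\<eta> (\<Sum>x<M. A x) * \<psi> A j))
        = (\<Sum>\<chi>\<in>mchars M. cnj (F \<chi> i) * F (twist M \<chi> (\<lambda>g. cnj (\<eta> g))) j)" for i j
      using plancherel[of M "\<lambda>A. \<psi> A i" "\<lambda>A. \<eta> (\<Sum>x<M. A x) * \<psi> A j"]
      by (simp add: F_def fourier_mult_char[OF that])
    have "?N ^ M * (\<Sum>A\<in>?O. \<eta> (\<Sum>x<M. A x) * ?Q (\<psi> A) (\<psi> A))
        = ?N ^ M * (\<Sum>A\<in>?O. \<Sum>i\<in>B. \<Sum>j\<in>B. E i j * (cnj (\<psi> A i) * (\<eta> (\<Sum>x<M. A x) * \<psi> A j)))"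
      unfolding cinner_apply by (simp add: sum_distrib_left mult_ac)
    also have "\<dots> = (\<Sum>i\<in>B. \<Sum>j\<in>B. E i j *
        (?N ^ M * (\<Sum>A\<in>?O. cnj (\<psi> A i) * (\<eta> (\<Sum>x<M. A x) * \<psi> A j))))"
      by (subst sum.swap, unfold sum_distrib_left, rule sum.cong[OF refl], subst sum.swap)
        (simp add: sum_distrib_left mult_ac)
    also have "\<dots> = (\<Sum>i\<in>B. \<Sum>j\<in>B. \<Sum>\<chi>\<in>mchars M. E i j *
        (cnj (F \<chi> i) * F (twist M \<chi> (\<lambda>g. cnj (\<eta> g))) j))"
      unfolding pw by (simp add: sum_distrib_left)
    also have "\<dots> = (\<Sum>\<chi>\<in>mchars M. ?Q (F \<chi>) (F (twist M \<chi> (\<lambda>g. cnj (\<eta> g)))))"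
      unfolding cinner_apply
      by (subst (2) sum.swap, rule sum.cong[OF refl], subst (2) sum.swap) (rule refl)
    finally show ?thesis .
  qed
  have "?N ^ Suc M * (\<Sum>A\<in>?O. of_bool ((\<Sum>x<M. A x) = g) * ?Q (\<psi> A) (\<psi> A))
      = ?N ^ M * (\<Sum>A\<in>?O. (\<Sum>\<eta>\<in>chars. \<eta> (\<Sum>x<M. A x) * cnj (\<eta> g)) * ?Q (\<psi> A) (\<psi> A))"
    unfolding sum_chars by (simp add: sum_distrib_left mult_ac)
  also have "\<dots> = (\<Sum>\<eta>\<in>chars. cnj (\<eta> g) * (?N ^ M * (\<Sum>A\<in>?O. \<eta> (\<Sum>x<M. A x) * ?Q (\<psi> A) (\<psi> A))))"
    unfolding sum_distrib_right by (subst sum.swap) (simp add: sum_distrib_left mult_ac)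
  also have "\<dots> = (\<Sum>\<eta>\<in>chars. cnj (\<eta> g) * (\<Sum>\<chi>\<in>mchars M. ?Q (F \<chi>) (F (twist M \<chi> (\<lambda>g. cnj (\<eta> g))))))"
    by (simp add: pl)
  also have "\<dots> = (\<Sum>\<chi>\<in>mchars M. \<Sum>\<eta>\<in>chars. cnj (\<eta> g) * ?Q (F \<chi>) (F (twist M \<chi> (\<lambda>g. cnj (\<eta> g)))))"
    unfolding sum_distrib_left by (rule sum.swap)
  finally show ?thesis by (simp add: sum.cartesian_product)
qed

lemma Re_of_bool: "Re (of_bool P) = of_bool P" and Im_of_bool: "Im (of_bool P) = 0"
  by (cases P, simp_all)+

text \<open>An interference term joins \<chi> to its twist. AM-GM charges it to the diagonal terms
  at its two ends, and \<open>card_twists\<close> limits how often each is charged.\<close>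

lemma outcome_bound:
  fixes M q :: nat and \<psi> :: "(nat \<Rightarrow> 'g::{ab_group_add,finite}) \<Rightarrow> 'b \<Rightarrow> complex"
  assumes psd: "psd_on B E" and q: "q < M"
    and low: "\<And>b. b \<in> B \<Longrightarrow> lowdeg M q (\<lambda>A. \<psi> A b)"
  defines "F \<equiv> \<lambda>\<chi> b. fourier M (\<lambda>A. \<psi> A b) \<chi>"
  shows "real CARD('g) ^ Suc M
      * (\<Sum>A\<in>oracles M. of_bool ((\<Sum>x<M. A x) = g) * Re (cinner_on B (\<psi> A) (apply_on B E (\<psi> A))))
    \<le> real (min (M div (M - q)) CARD('g))
      * (\<Sum>\<chi>\<in>mchars M. Re (cinner_on B (F \<chi>) (apply_on B E (F \<chi>))))"
proof -
  let ?Q = "\<lambda>u v. cinner_on B u (apply_on B E v)"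
  let ?P = "mchars M \<times> chars :: ((nat \<Rightarrow> 'g \<Rightarrow> complex) \<times> ('g \<Rightarrow> complex)) set"
  let ?tw = "\<lambda>\<chi> \<eta>. twist M \<chi> (\<lambda>g. cnj (\<eta> g))"
  \<comment> \<open>Reversal of an interference term: its ends are exchanged and \<eta> is
    conjugated.\<close>
  let ?\<tau> = "\<lambda>(\<chi>, \<eta>). (?tw \<chi> \<eta>, \<lambda>g. cnj (\<eta> g))"
  define e where "e \<chi> = Re (?Q (F \<chi>) (F \<chi>))" for \<chi>
  define a where "a = (\<lambda>(\<chi>, \<eta>). Re (cnj (\<eta> g) * ?Q (F \<chi>) (F (?tw \<chi> \<eta>))))"
  \<comment> \<open>\<open>I\<close> selects the terms with both ends of low weight, the only ones
    that can be nonzero.\<close>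
  define I :: "(nat \<Rightarrow> 'g \<Rightarrow> complex) \<times> ('g \<Rightarrow> complex) \<Rightarrow> real"
    where "I = (\<lambda>(\<chi>, \<eta>). of_bool (weight M \<chi> \<le> q \<and> weight M (?tw \<chi> \<eta>) \<le> q))"
  have e_nonneg: "0 \<le> e \<chi>" for \<chi> using psd by (simp add: e_def psd_on_def)
  have \<tau>\<tau>: "?\<tau> (?\<tau> p) = p" "?\<tau> p \<in> ?P" if "p \<in> ?P" for p
    using that by (auto simp: twist_twist_cnj twist_mchars chars_cnj)
  have reindex: "(\<Sum>p\<in>?P. f (?\<tau> p)) = (\<Sum>p\<in>?P. f p)" for f :: "_ \<Rightarrow> real"
    by (rule sum.reindex_bij_witness[of _ ?\<tau> ?\<tau>]) (use \<tau>\<tau> in auto)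
  have I\<tau>: "I (?\<tau> p) = I p" if "p \<in> ?P" for p
    using that by (auto simp: I_def twist_twist_cnj)
  \<comment> \<open>Pairing each interference term with its reverse makes AM-GM applicable without Hermitian symmetry of \<open>E\<close>.\<close>
  have pair: "a p + a (?\<tau> p) \<le> I p * e (fst p) + I (?\<tau> p) * e (fst (?\<tau> p))" if p: "p \<in> ?P" for p
  proof -
    obtain \<chi> \<eta> where *: "p = (\<chi>, \<eta>)" "\<chi> \<in> mchars M" "\<eta> \<in> chars" using p by auto
    have inv: "?tw (?tw \<chi> \<eta>) (\<lambda>g. cnj (\<eta> g)) = \<chi>" using twist_twist_cnj[OF *(2,3)] by simp
    have sum: "a p + a (?\<tau> p) = Re (cnj (\<eta> g) * ?Q (F \<chi>) (F (?tw \<chi> \<eta>)))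
        + Re (cnj (cnj (\<eta> g)) * ?Q (F (?tw \<chi> \<eta>)) (F \<chi>))"
      using inv by (simp add: a_def *)
    show ?thesis
    proof (cases "weight M \<chi> \<le> q \<and> weight M (?tw \<chi> \<eta>) \<le> q")
      case True
      then have "I p = 1" by (simp add: I_def *)
      then show ?thesis
        using psd_cross[OF psd, of "cnj (\<eta> g)" "F \<chi>" "F (?tw \<chi> \<eta>)"] sum I\<tau>[OF p] chars_norm[OF *(3)]
        by (simp add: e_def *)
    next
      case False
      have "?tw \<chi> \<eta> \<in> mchars M" using * by (simp add: twist_mchars chars_cnj)
      then have "(\<forall>b\<in>B. F \<chi> b = 0) \<or> (\<forall>b\<in>B. F (?tw \<chi> \<eta>) b = 0)"
        using False low *(2) unfolding F_def lowdeg_def by (meson not_le)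
      then have "?Q (F \<chi>) (F (?tw \<chi> \<eta>)) = 0 \<and> ?Q (F (?tw \<chi> \<eta>)) (F \<chi>) = 0"
        unfolding cinner_apply by auto
      then have "a p + a (?\<tau> p) = 0" using sum by simp
      moreover have "I p = 0" using False by (simp add: I_def *)
      ultimately show ?thesis using I\<tau>[OF p] by simp
    qed
  qed
  have "real CARD('g) ^ Suc M
      * (\<Sum>A\<in>oracles M. of_bool ((\<Sum>x<M. A x) = g) * Re (?Q (\<psi> A) (\<psi> A)))
      = Re (of_nat CARD('g) ^ Suc M
      * (\<Sum>A\<in>oracles M. of_bool ((\<Sum>x<M. A x) = g) * ?Q (\<psi> A) (\<psi> A)))"
    by (simp add: of_nat_power[symmetric] Re_of_bool Im_of_bool del: of_nat_power of_nat_mult power_Suc)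
  also have "\<dots> = (\<Sum>p\<in>?P. a p)"
    unfolding outcome_fourier a_def F_def by (simp add: case_prod_unfold)
  \<comment> \<open>Reversal permutes \<open>?P\<close>, so adding each term to its reversal counts
    everything twice.\<close>
  also have "2 * \<dots> = (\<Sum>p\<in>?P. a p + a (?\<tau> p))"
    unfolding sum.distrib reindex by simp
  also have "\<dots> \<le> (\<Sum>p\<in>?P. I p * e (fst p) + I (?\<tau> p) * e (fst (?\<tau> p)))"
    by (intro sum_mono pair)
  also have "\<dots> = 2 * (\<Sum>p\<in>?P. I p * e (fst p))"
    unfolding sum.distrib reindex[of "\<lambda>p. I p * e (fst p)"] by simp
  also have "(\<Sum>p\<in>?P. I p * e (fst p)) = (\<Sum>\<chi>\<in>mchars M. \<Sum>\<eta>\<in>chars. I (\<chi>, \<eta>) * e \<chi>)"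
    by (simp add: sum.cartesian_product case_prod_unfold)
  also have "2 * \<dots> \<le> 2 * (\<Sum>\<chi>\<in>mchars M. real (min (M div (M - q)) CARD('g)) * e \<chi>)"
  proof (intro mult_left_mono sum_mono)
    fix \<chi> :: "nat \<Rightarrow> 'g \<Rightarrow> complex" assume \<chi>: "\<chi> \<in> mchars M"
    have "(\<Sum>\<eta>\<in>chars. I (\<chi>, \<eta>)) \<le> (\<Sum>\<eta>\<in>chars. of_bool (weight M (?tw \<chi> \<eta>) \<le> q))"
      unfolding I_def by (intro sum_mono) simp
    also have "\<dots> = real (card {\<eta> \<in> chars. weight M (?tw \<chi> \<eta>) \<le> q})"
      by (simp add: finite_chars of_bool_def sum.If_cases Int_def)
    also have "\<dots> \<le> real (min (M div (M - q)) CARD('g))"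
      using card_twists[OF \<chi> q] by (simp only: of_nat_le_iff)
    finally show "(\<Sum>\<eta>\<in>chars. I (\<chi>, \<eta>) * e \<chi>) \<le> real (min (M div (M - q)) CARD('g)) * e \<chi>"
      unfolding sum_distrib_right[symmetric] by (rule mult_right_mono[OF _ e_nonneg])
  qed simp
  finally show ?thesis unfolding e_def sum_distrib_left[symmetric] by linarith
qed

text \<open>When \<open>outcome_bound\<close> is added over all outcomes, completeness of the
  measurement turns the right side into the total Fourier mass.\<close>

theorem success_prob_upper:
  fixes alg :: "'g::{ab_group_add,finite} query_algorithm"
  assumes valid: "valid_algorithm M q alg" and q: "q < M"
  shows "success_prob M q alg \<le> real (min (M div (M - q)) CARD('g)) / real CARD('g)"
proof -
  let ?B = "basis_states M (workdim alg) :: 'g basis set"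
  let ?N = "real CARD('g)" and ?n = "real (min (M div (M - q)) CARD('g))"
  let ?Q = "\<lambda>g u. cinner_on ?B u (apply_on ?B (meas alg g) u)"
  let ?O = "oracles M :: (nat \<Rightarrow> 'g) set"
  define \<psi> where "\<psi> A = state_after M alg A q" for A
  define F where "F \<chi> b = fourier M (\<lambda>A. \<psi> A b) \<chi>" for \<chi> b
  have povm: "povm_on ?B (meas alg)" using valid by (simp add: valid_algorithm_def Let_def)
  have norm: "cinner_on ?B (\<psi> A) (\<psi> A) = 1" for A
    unfolding \<psi>_def using cinner_state[OF valid order_refl] .
  \<comment> \<open>One factor \<open>?N ^ M\<close> comes from Plancherel, the other from the
    number of oracles, each with a unit state.\<close>
  have "(\<Sum>\<chi>\<in>mchars M. cinner_on ?B (F \<chi>) (F \<chi>))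
      = (\<Sum>b\<in>?B. \<Sum>\<chi>\<in>mchars M. cnj (F \<chi> b) * F \<chi> b)"
    unfolding cinner_on_def by (rule sum.swap)
  also have "\<dots> = of_nat CARD('g) ^ M * (\<Sum>A\<in>?O. cinner_on ?B (\<psi> A) (\<psi> A))"
    unfolding F_def plancherel cinner_on_def sum_distrib_left by (rule sum.swap)
  also have "\<dots> = of_real (?N ^ M * ?N ^ M)" by (simp add: norm card_oracles)
  finally have total: "(\<Sum>\<chi>\<in>mchars M. cinner_on ?B (F \<chi>) (F \<chi>)) = of_real (?N ^ M * ?N ^ M)" .
  have "?N ^ Suc M * (?N ^ M * success_prob M q alg)
      = ?N ^ Suc M * (\<Sum>A\<in>?O. Re (?Q (\<Sum>x<M. A x) (\<psi> A)))"
    by (simp add: success_prob_def output_prob_def Let_def card_oracles \<psi>_def)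
  \<comment> \<open>Oracles are sorted by their sum \<open>g\<close>, so that a single measurement
    operator occurs in each part.\<close>
  also have "\<dots> = ?N ^ Suc M * (\<Sum>A\<in>?O. \<Sum>g\<in>UNIV. of_bool ((\<Sum>x<M. A x) = g) * Re (?Q g (\<psi> A)))"
    by (simp add: sum_of_bool_eq)
  also have "\<dots> = (\<Sum>g\<in>UNIV. ?N ^ Suc M * (\<Sum>A\<in>?O. of_bool ((\<Sum>x<M. A x) = g) * Re (?Q g (\<psi> A))))"
    unfolding sum_distrib_left by (rule sum.swap)
  also have "\<dots> \<le> (\<Sum>g\<in>UNIV. ?n * (\<Sum>\<chi>\<in>mchars M. Re (?Q g (F \<chi>))))"
  proof (rule sum_mono)
    fix g :: 'g
    have "psd_on ?B (meas alg g)" using povm by (simp add: povm_on_def)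
    then show "?N ^ Suc M * (\<Sum>A\<in>?O. of_bool ((\<Sum>x<M. A x) = g) * Re (?Q g (\<psi> A)))
        \<le> ?n * (\<Sum>\<chi>\<in>mchars M. Re (?Q g (F \<chi>)))"
      unfolding F_def by (rule outcome_bound[OF _ q]) (simp add: \<psi>_def lowdeg_state)
  qed
  also have "\<dots> = ?n * (\<Sum>\<chi>\<in>mchars M. Re (\<Sum>g\<in>UNIV. ?Q g (F \<chi>)))"
    unfolding sum_distrib_left[symmetric] Re_sum by (subst sum.swap) (rule refl)
  also have "\<dots> = ?n * (?N ^ M * ?N ^ M)"
    unfolding povm_sum[OF povm finite_basis_states] Re_sum[symmetric] total by simp
  finally have "(?N ^ M * ?N ^ M) * (?N * success_prob M q alg) \<le> (?N ^ M * ?N ^ M) * ?n"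
    by (simp add: mult_ac)
  then show ?thesis by (simp add: field_simps)
qed

section \<open>Monomial unitaries and sums over basis states\<close>

lemma unitary_monomial:
  assumes "finite B" and inv: "\<And>b. b \<in> B \<Longrightarrow> \<pi> b \<in> B \<and> \<pi> (\<pi> b) = b"
    and d: "\<And>b. b \<in> B \<Longrightarrow> cmod (d b) = 1"
  shows "unitary_on B (\<lambda>b b'. of_bool (b = \<pi> b') * d b')"
  unfolding unitary_on_def
proof (intro ballI conjI)
  fix i j assume ij: "i \<in> B" "j \<in> B"
  have dd: "d b * cnj (d b) = 1" "cnj (d b) * d b = 1" if "b \<in> B" for b
    using d[OF that] by (simp_all add: complex_norm_square[symmetric] mult.commute)
  have eq: "b = \<pi> b' \<longleftrightarrow> \<pi> b = b'" if "b \<in> B" "b' \<in> B" for b b' using inv that by metis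
  have "(\<Sum>k\<in>B. cnj (of_bool (k = \<pi> i) * d i) * (of_bool (k = \<pi> j) * d j))
      = (\<Sum>k\<in>B. of_bool (\<pi> i = k) * (of_bool (k = \<pi> j) * (cnj (d i) * d j)))"
    by (intro sum.cong) (auto simp: of_bool_def)
  also have "\<dots> = of_bool (i = j)"
    using ij inv eq assms(1) dd by (subst sum_of_bool_eq) auto
  finally show "(\<Sum>k\<in>B. cnj (of_bool (k = \<pi> i) * d i) * (of_bool (k = \<pi> j) * d j)) = of_bool (i = j)" .
  have "(\<Sum>k\<in>B. of_bool (i = \<pi> k) * d k * cnj (of_bool (j = \<pi> k) * d k))
      = (\<Sum>k\<in>B. of_bool (\<pi> i = k) * (of_bool (\<pi> j = k) * (d k * cnj (d k))))"
    using ij eq by (intro sum.cong) (auto simp: of_bool_def)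
  also have "\<dots> = of_bool (i = j)"
    using ij inv eq assms(1) dd by (subst sum_of_bool_eq) auto
  finally show "(\<Sum>k\<in>B. of_bool (i = \<pi> k) * d k * cnj (of_bool (j = \<pi> k) * d k)) = of_bool (i = j)" .
qed

lemma apply_monomial:
  assumes "finite B" and inv: "\<And>b. b \<in> B \<Longrightarrow> \<pi> b \<in> B \<and> \<pi> (\<pi> b) = b" and "b \<in> B"
  shows "apply_on B (\<lambda>b b'. of_bool (b = \<pi> b') * d b') v b = d (\<pi> b) * v (\<pi> b)"
proof -
  have "b = \<pi> b' \<longleftrightarrow> \<pi> b = b'" if "b' \<in> B" for b' using inv that \<open>b \<in> B\<close> by metis
  then have "apply_on B (\<lambda>b b'. of_bool (b = \<pi> b') * d b') v b
      = (\<Sum>b'\<in>B. of_bool (\<pi> b = b') * (d b' * v b'))"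
    unfolding apply_on_def by (intro sum.cong) (auto simp: of_bool_def)
  then show ?thesis using assms by (simp add: sum_of_bool_eq)
qed

lemma sum_basis_states:
  "(\<Sum>b\<in>basis_states M w. f b) = (\<Sum>x<M. \<Sum>g\<in>(UNIV::'g::finite set). \<Sum>z<w. f (x, g, z))"
  by (simp add: basis_states_def sum.cartesian_product case_prod_unfold)

subsection \<open>An optimal algorithm\<close>

text \<open>
  Branch \<open>j\<close> of the workspace queries the positions \<open>e j i\<close>, \<open>i < q\<close>. With the response register in the
  state \<open>\<Sum>\<^sub>g cnj (\<phi> g) |g\<rangle>\<close> for a character \<open>\<phi>\<close>, a query at \<open>x\<close> multiplies the amplitude by \<open>\<phi> (A x)\<close>.
  The last gate returns the first two registers to a state that does not depend on \<open>j\<close>, so that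
  the branches interfere.
\<close>

locale phase_algorithm =
  fixes M q n :: nat
    and \<eta> C :: "nat \<Rightarrow> 'g::{ab_group_add,finite} \<Rightarrow> complex"
    and e :: "nat \<Rightarrow> nat \<Rightarrow> nat"
  assumes M_pos: "0 < M" and n_pos: "0 < n"
    and \<eta>: "j < n \<Longrightarrow> \<eta> j \<in> chars" and \<eta>_inj: "inj_on \<eta> {..<n}" and C: "x < M \<Longrightarrow> C x \<in> chars"
    and e_inj: "j < n \<Longrightarrow> inj_on (e j) {..<q}"
    and e_less: "j < n \<Longrightarrow> i < q \<Longrightarrow> e j i < M"
    and e_cover: "j < n \<Longrightarrow> x < M \<Longrightarrow> C x \<noteq> \<eta> j \<Longrightarrow> x \<in> e j ` {..<q}"
begin

abbreviation B :: "'g basis set" where "B \<equiv> basis_states M n"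

text \<open>The default \<open>0\<close> past the last query is the common final position of all
  branches.\<close>

definition pos :: "nat \<Rightarrow> nat \<Rightarrow> nat" where
  "pos j k = (if k < q then e j k else 0)"

text \<open>Each query in branch \<open>j\<close> contributes a component of \<open>C\<close>
  divided by \<open>\<eta> j\<close>. The trivial character past the last query makes the response
  register independent of \<open>j\<close>.\<close>

definition phase :: "nat \<Rightarrow> nat \<Rightarrow> 'g \<Rightarrow> complex" where
  "phase j k = (if k < q then \<lambda>g. C (e j k) g * cnj (\<eta> j g) else (\<lambda>_. 1))"

text \<open>The closed form confirmed by \<open>state_after\<close>: phases of the first
  \<open>k\<close> queries, with both registers prepared for the next one.\<close>

definition state :: "(nat \<Rightarrow> 'g) \<Rightarrow> nat \<Rightarrow> 'g basis \<Rightarrow> complex" where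
  "state A k = (\<lambda>(x, g, j). (\<Prod>i<k. phase j i (A (pos j i))) * of_bool (x = pos j k)
     * cnj (phase j k g) / of_real (sqrt (n * CARD('g))))"

text \<open>Within each branch, a transposition of the old and the new position, hence an involution
  as \<open>unitary_monomial\<close> demands.\<close>

definition move :: "nat \<Rightarrow> 'g basis \<Rightarrow> 'g basis" where
  "move k = (\<lambda>(x, g, j). (if x = pos j k then pos j (Suc k) else if x = pos j (Suc k) then pos j k else x, g, j))"

definition rephase :: "nat \<Rightarrow> 'g basis \<Rightarrow> complex" where
  "rephase k = (\<lambda>(x, g, j). phase j k g * cnj (phase j (Suc k) g))"

text \<open>\<open>undefined\<close> stands for the oracle at \<open>k = 0\<close>, where the
  product of phases is empty. On the branch register, \<open>meas\<close> is the rank-one operator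
  of the vector with entries \<open>cnj (\<eta> j s) / sqrt CARD('g)\<close>.\<close>

definition algorithm :: "'g query_algorithm" where
  "algorithm = \<lparr>workdim = n, start = state undefined 0,
     gate = (\<lambda>k. case k of 0 \<Rightarrow> \<lambda>b b'. of_bool (b = b')
       | Suc k \<Rightarrow> \<lambda>b b'. of_bool (b = move k b') * rephase k b'),
     meas = (\<lambda>s (x, g, j) (x', g', j'). of_bool (x = x') * (of_bool (g = g') * (cnj (\<eta> j s) * \<eta> j' s / of_nat CARD('g))))\<rparr>"

lemma workdim_algorithm [simp]: "workdim algorithm = n"
  by (simp add: algorithm_def)

lemma pos_less: "j < n \<Longrightarrow> pos j k < M"
  by (simp add: pos_def e_less M_pos)

lemma phase_chars: "j < n \<Longrightarrow> phase j k \<in> chars"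
  by (simp add: phase_def chars_mult chars_cnj C \<eta> e_less chars_one)

lemma move: "b \<in> B \<Longrightarrow> move k b \<in> B \<and> move k (move k b) = b"
  by (auto simp: move_def basis_states_def pos_less)

lemma norm_rephase: "b \<in> B \<Longrightarrow> cmod (rephase k b) = 1"
  by (auto simp: rephase_def basis_states_def norm_mult chars_norm phase_chars)

text \<open>Row \<open>b\<close> of the gate reads the state at \<open>move k b\<close>, and
  shifting the response there by \<open>A y\<close> pulls out the phase of the query.\<close>

lemma state_after: "b \<in> B \<Longrightarrow> state_after M algorithm A k b = state A k b"
proof (induction k arbitrary: b)
  case 0
  then show ?case
    by (simp add: algorithm_def apply_on_def sum_of_bool_eq finite_basis_states)
      (simp add: state_def case_prod_unfold)
next
  case (Suc k)
  obtain x g j where b: "b = (x, g, j)" by (metis prod_cases3)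
  with Suc.prems have j: "j < n" by (simp add: basis_states_def)
  define y where "y = fst (move k b)"
  have y: "move k b = (y, g, j)" "(y, g, j) \<in> B" "(y, g - A y, j) \<in> B"
    using move[OF Suc.prems, of k] by (auto simp: y_def b move_def basis_states_def)
  have "state_after M algorithm A (Suc k) b
      = rephase k (y, g, j) * apply_on B (query_op A) (state_after M algorithm A k) (y, g, j)"
    using apply_monomial[OF finite_basis_states move[of _ k] Suc.prems] by (simp add: algorithm_def y(1))
  also have "\<dots> = rephase k (y, g, j) * state A k (y, g - A y, j)"
    by (simp only: apply_query[OF y(2)] Suc.IH[OF y(3)])
  also have "\<dots> = state A (Suc k) b"
  proof -
    have "phase j k (g - A y) = phase j k g * cnj (phase j k (A y))"
      using chars_add[OF phase_chars[OF j], of k g "- A y"] chars_uminus[OF phase_chars[OF j]] by simp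
    moreover have "phase j k g * cnj (phase j k g) = 1" using chars_mult_cnj[OF phase_chars[OF j]] by simp
    moreover have "y = pos j k \<longleftrightarrow> x = pos j (Suc k)" by (auto simp: y_def b move_def)
    ultimately show ?thesis by (auto simp: b state_def rephase_def)
  qed
  finally show ?case .
qed

text \<open>The rank-one form yields squares, which gives positivity in \<open>valid\<close> and the
  value in \<open>output_prob\<close>.\<close>

lemma meas_value:
  "cinner_on B v (apply_on B (meas algorithm s) v)
    = of_real (\<Sum>x<M. \<Sum>g\<in>UNIV. (cmod (\<Sum>j<n. \<eta> j s * v (x, g, j)))\<^sup>2 / CARD('g))"
proof -
  have "cinner_on B v (apply_on B (meas algorithm s) v)
      = (\<Sum>x<M. \<Sum>g\<in>UNIV. \<Sum>j<n. \<Sum>x'<M. of_bool (x = x') * (\<Sum>g'\<in>UNIV. of_bool (g = g')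
          * (\<Sum>j'<n. cnj (\<eta> j s) * \<eta> j' s / of_nat CARD('g) * (cnj (v (x, g, j)) * v (x', g', j')))))"
    unfolding cinner_apply sum_basis_states
    by (simp add: algorithm_def sum_distrib_left mult.assoc)
  also have "\<dots> = (\<Sum>x<M. \<Sum>g\<in>UNIV. \<Sum>j<n. \<Sum>j'<n.
      cnj (\<eta> j s) * \<eta> j' s / of_nat CARD('g) * (cnj (v (x, g, j)) * v (x, g, j')))"
    by (rule sum.cong[OF refl])+ (simp add: sum_of_bool_eq)
  also have "\<dots> = (\<Sum>x<M. \<Sum>g\<in>UNIV. cnj (\<Sum>j<n. \<eta> j s * v (x, g, j)) * (\<Sum>j<n. \<eta> j s * v (x, g, j)) / of_nat CARD('g))"
    unfolding cnj_sum sum_product sum_divide_distrib by (intro sum.cong refl) simp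
  also have "\<dots> = of_real (\<Sum>x<M. \<Sum>g\<in>UNIV. (cmod (\<Sum>j<n. \<eta> j s * v (x, g, j)))\<^sup>2 / CARD('g))"
    by (simp only: mult.commute[of "cnj _"] complex_norm_square[symmetric]) simp
  finally show ?thesis .
qed

lemma valid: "valid_algorithm M q algorithm"
proof -
  have "cinner_on B (state undefined 0) (state undefined 0)
      = (\<Sum>x<M. \<Sum>g\<in>(UNIV::'g set). \<Sum>j<n. of_bool (pos j 0 = x) * (1 / of_nat (n * CARD('g))))"
    unfolding cinner_on_def sum_basis_states
  proof (intro sum.cong refl)
    fix x g j assume "j \<in> {..<n}"
    then have "phase j 0 g * cnj (phase j 0 g) = 1" using chars_mult_cnj[OF phase_chars] by simp
    moreover have "complex_of_real (sqrt (n * CARD('g))) * of_real (sqrt (n * CARD('g))) = of_nat (n * CARD('g))"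
      unfolding of_real_mult[symmetric] by (subst real_sqrt_mult_self) simp
    ultimately show "cnj (state undefined 0 (x, g, j)) * state undefined 0 (x, g, j)
        = of_bool (pos j 0 = x) * (1 / of_nat (n * CARD('g)))"
      by (auto simp: state_def simp del: of_nat_mult of_real_sqrt)
  qed
  \<comment> \<open>Summing over \<open>x\<close> first: for given \<open>g\<close> and
    \<open>j\<close> a single position is occupied.\<close>
  also have "\<dots> = (\<Sum>g\<in>(UNIV::'g set). \<Sum>j<n. \<Sum>x<M. of_bool (pos j 0 = x) * (1 / of_nat (n * CARD('g))))"
    by (subst sum.swap, rule sum.cong[OF refl], rule sum.swap)
  also have "\<dots> = (\<Sum>g\<in>(UNIV::'g set). \<Sum>j<n. 1 / of_nat (n * CARD('g)))"
    by (intro sum.cong refl sum_of_bool_eq) (simp_all add: pos_less)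
  also have "\<dots> = 1" using n_pos by simp
  finally have start: "cinner_on B (state undefined 0) (state undefined 0) = 1" .
  have "unitary_on B (gate algorithm k)" for k
  proof (cases k)
    case 0
    then show ?thesis using unitary_monomial[OF finite_basis_states[of M n], of "\<lambda>b. b" "\<lambda>_. 1"] by (simp add: algorithm_def)
  next
    case (Suc k)
    then show ?thesis using unitary_monomial[OF finite_basis_states move[of _ k] norm_rephase[of _ k]] by (simp add: algorithm_def)
  qed
  moreover have "povm_on B (meas algorithm)"
    unfolding povm_on_def psd_on_def meas_value
  proof (intro conjI allI ballI)
    fix b b' assume "b \<in> B" "b' \<in> B"
    obtain x g j x' g' j' where b: "b = (x, g, j)" "b' = (x', g', j')" by (metis prod_cases3)
    have j: "j < n" "j' < n" using \<open>b \<in> B\<close> \<open>b' \<in> B\<close> by (simp_all add: b basis_states_def)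
    have "(\<Sum>s\<in>UNIV. meas algorithm s b b')
        = of_bool (x = x') * of_bool (g = g') * (\<Sum>s\<in>UNIV. cnj (\<eta> j s) * \<eta> j' s) / of_nat CARD('g)"
      by (simp add: algorithm_def b sum_distrib_left sum_divide_distrib mult.assoc)
    \<comment> \<open>Distinct branches carry distinct characters, so the off-diagonal entries
      cancel.\<close>
    also have "(\<Sum>s\<in>UNIV. cnj (\<eta> j s) * \<eta> j' s) = of_bool (j = j') * of_nat CARD('g)"
      using chars_orthogonal[OF \<eta> \<eta>] j inj_onD[OF \<eta>_inj, of j j'] by (cases "j = j'") auto
    finally show "(\<Sum>s\<in>UNIV. meas algorithm s b b') = of_bool (b = b')"
      by (simp add: b)
  qed (auto intro!: sum_nonneg)
  ultimately show ?thesis using start by (simp add: valid_algorithm_def algorithm_def Let_def)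
qed

text \<open>All branches share the phase \<open>?P\<close> and differ only by
  \<open>cnj (\<eta> j ?s)\<close>, which the measurement for \<open>?s\<close> compensates; the
  \<open>n\<close> amplitudes add coherently.\<close>

lemma output_prob:
  "output_prob M q algorithm A (\<Sum>x<M. A x) = real n / real CARD('g)"
proof -
  let ?s = "\<Sum>x<M. A x"
  let ?P = "\<Prod>x<M. C x (A x)"
  have P: "(\<Prod>i<q. phase j i (A (pos j i))) = ?P * cnj (\<eta> j ?s)" if j: "j < n" for j
  proof -
    have "(\<Prod>i<q. phase j i (A (pos j i))) = (\<Prod>i<q. C (e j i) (A (e j i)) * cnj (\<eta> j (A (e j i))))"
      by (simp add: phase_def pos_def)
    also have "\<dots> = (\<Prod>x\<in>e j ` {..<q}. C x (A x) * cnj (\<eta> j (A x)))"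
      by (simp add: prod.reindex[OF e_inj[OF j]])
    \<comment> \<open>Positions not queried have \<open>C x = \<eta> j\<close> by
      \<open>e_cover\<close> and contribute \<open>1\<close>.\<close>
    also have "\<dots> = (\<Prod>x<M. C x (A x) * cnj (\<eta> j (A x)))"
    proof (rule prod.mono_neutral_left)
      show "\<forall>x\<in>{..<M} - e j ` {..<q}. C x (A x) * cnj (\<eta> j (A x)) = 1"
        using e_cover[OF j] chars_mult_cnj[OF \<eta>[OF j]] by (metis Diff_iff lessThan_iff)
    qed (use e_less[OF j] in auto)
    finally show ?thesis by (simp add: prod.distrib chars_sum[OF \<eta>[OF j]])
  qed
  have state: "(\<Sum>j<n. \<eta> j ?s * state A q (x, g, j)) = of_nat n * ?P / of_real (sqrt (n * CARD('g))) * of_bool (x = 0)" for x g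
  proof -
    have "(\<Sum>j<n. \<eta> j ?s * state A q (x, g, j)) = (\<Sum>j<n. ?P / of_real (sqrt (n * CARD('g))) * of_bool (x = 0))"
    proof (rule sum.cong[OF refl])
      fix j assume "j \<in> {..<n}"
      then have j: "j < n" by simp
      have "\<eta> j ?s * state A q (x, g, j) = (\<eta> j ?s * cnj (\<eta> j ?s)) * (?P / of_real (sqrt (n * CARD('g))) * of_bool (x = 0))"
        by (simp add: state_def P[OF j] del: of_nat_mult of_real_sqrt) (simp add: pos_def phase_def)
      then show "\<eta> j ?s * state A q (x, g, j) = ?P / of_real (sqrt (n * CARD('g))) * of_bool (x = 0)"
        by (simp only: chars_mult_cnj[OF \<eta>[OF j]] mult_1)
    qed
    then show ?thesis by simp
  qed
  have "cmod ?P = 1" using C by (simp add: prod_norm[symmetric] chars_norm)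
  then have norm: "(cmod (\<Sum>j<n. \<eta> j ?s * state A q (x, g, j)))\<^sup>2 = of_bool (0 = x) * (real n / CARD('g))" for x g
    unfolding state using n_pos
    by (simp add: norm_mult norm_divide power_divide power_mult_distrib power2_eq_square[of "real n"])
  have eq: "cinner_on B (state_after M algorithm A q) (apply_on B (meas algorithm ?s) (state_after M algorithm A q))
      = cinner_on B (state A q) (apply_on B (meas algorithm ?s) (state A q))"
    unfolding cinner_on_def apply_on_def by (intro sum.cong refl) (simp add: state_after)
  have "output_prob M q algorithm A ?s = (\<Sum>x<M. of_bool (0 = x) * (\<Sum>g\<in>(UNIV::'g set). real n / CARD('g) / CARD('g)))"
    unfolding output_prob_def Let_def workdim_algorithm eq
    unfolding meas_value norm by simp
  also have "\<dots> = real n / CARD('g)"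
    using M_pos by (subst sum_of_bool_eq) auto
  finally show ?thesis .
qed

lemma success_prob: "success_prob M q algorithm = real n / real CARD('g)"
  by (simp add: success_prob_def output_prob card_oracles)

end

section \<open>Choice of characters and query positions, and the exact maximum\<close>

theorem success_prob_attained:
  assumes q: "q < M"
  defines "n \<equiv> min (M div (M - q)) CARD('g::{ab_group_add,finite})"
  shows "\<exists>alg :: 'g query_algorithm. valid_algorithm M q alg \<and> success_prob M q alg = real n / real CARD('g)"
proof -
  define d where "d = M - q"
  have d: "0 < d" "d \<le> M" using q by (simp_all add: d_def)
  have n: "0 < n" "n * d \<le> M" "n \<le> CARD('g)"
  proof -
    show "0 < n" using d by (simp add: n_def d_def[symmetric] div_greater_zero_iff)
    have "n * d \<le> M div d * d" by (simp add: n_def d_def)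
    then show "n * d \<le> M" using div_times_less_eq_dividend le_trans by blast
  qed (simp add: n_def)
  obtain \<eta> :: "nat \<Rightarrow> 'g \<Rightarrow> complex" where bij: "bij_betw \<eta> {0..<CARD('g)} chars"
    using ex_bij_betw_nat_finite[OF finite_chars] unfolding card_chars by blast
  then have \<eta>: "\<eta> j \<in> chars" if "j < n" for j using that n by (auto simp: bij_betw_def)
  have inj: "inj_on \<eta> {..<n}"
    using bij n by (auto simp: bij_betw_def intro: inj_on_subset)
  \<comment> \<open>Positions fall into \<open>n\<close> blocks of length at least \<open>d\<close>;
    \<open>min\<close> assigns the leftover ones to the last block.\<close>
  define \<iota> where "\<iota> x = min (x div d) (n - 1)" for x
  have \<iota>: "\<iota> x < n" for x using n by (auto simp: \<iota>_def min_def)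
  let ?S = "\<lambda>j. {x \<in> {..<M}. \<eta> (\<iota> x) \<noteq> \<eta> j}"
  \<comment> \<open>Block \<open>j\<close> can be skipped in branch \<open>j\<close>, which leaves
    at most \<open>M - d = q\<close> positions; they are padded to exactly \<open>q\<close>.\<close>
  have "\<exists>f. inj_on f {..<q} \<and> ?S j \<subseteq> f ` {..<q} \<and> f ` {..<q} \<subseteq> {..<M}" if j: "j < n" for j
  proof -
    have sub: "{j * d..<Suc j * d} \<subseteq> {..<M}"
    proof -
      have "Suc j * d \<le> n * d" using j by (intro mult_right_mono) auto
      then show ?thesis using n(2) by auto
    qed
    have "\<iota> x = j" if "x \<in> {j * d..<Suc j * d}" for x
    proof -
      have "x div d = j" using that by (intro div_nat_eqI) (auto simp: mult.commute)
      then show ?thesis using j by (simp add: \<iota>_def)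
    qed
    then have "?S j \<subseteq> {..<M} - {j * d..<Suc j * d}" by auto
    then have "card (?S j) \<le> card ({..<M} - {j * d..<Suc j * d})" by (intro card_mono) auto
    also have "\<dots> = M - d" using sub by (subst card_Diff_subset) auto
    also have "\<dots> = q" using q by (simp add: d_def)
    finally obtain T where T: "?S j \<subseteq> T" "T \<subseteq> {..<M}" "card T = q"
      using exists_subset_between[of "?S j" q "{..<M}"] q by auto
    then have "finite T" using finite_subset by blast
    then obtain f where "bij_betw f {0..<q} T" using ex_bij_betw_nat_finite T(3) by blast
    then show ?thesis using T by (intro exI[of _ f]) (auto simp: bij_betw_def atLeast0LessThan)
  qed
  then have "\<forall>j. \<exists>f. j < n \<longrightarrow> inj_on f {..<q} \<and> ?S j \<subseteq> f ` {..<q} \<and> f ` {..<q} \<subseteq> {..<M}" by blast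
  from choice[OF this] obtain e
    where e: "\<And>j. j < n \<Longrightarrow> inj_on (e j) {..<q} \<and> ?S j \<subseteq> e j ` {..<q} \<and> e j ` {..<q} \<subseteq> {..<M}"
    by blast
  have cover: "x \<in> e j ` {..<q}" if "j < n" "x < M" "\<eta> (\<iota> x) \<noteq> \<eta> j" for j x
    using e[OF that(1)] that(2,3) by blast
  interpret phase_algorithm M q n \<eta> "\<lambda>x. \<eta> (\<iota> x)" e
    by unfold_locales (use q n \<eta> \<iota> inj e cover in \<open>simp_all add: image_subset_iff\<close>)
  show ?thesis using valid success_prob by blast
qed

theorem theorem4:
  fixes M q :: nat
  assumes "M \<ge> 1" and "q < M"
  shows "is_max_success_prob TYPE('g::{ab_group_add,finite}) M q
           (min (of_int \<lfloor>real M / (real M - real q)\<rfloor> / real CARD('g)) 1)"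
proof -
  \<comment> \<open>With \<open>q < M\<close>, real and truncated subtraction agree, and the floor
    of a quotient of naturals is \<open>div\<close>.\<close>
  have "\<lfloor>real M / (real M - real q)\<rfloor> = int (M div (M - q))"
    using floor_divide_of_nat_eq[of M "M - q", where ?'a = real] assms(2) by (simp add: of_nat_diff)
  then have eq: "min (of_int \<lfloor>real M / (real M - real q)\<rfloor> / real CARD('g)) 1
      = real (min (M div (M - q)) CARD('g)) / real CARD('g)"
    by (auto simp: min_def field_simps)
  show ?thesis
    unfolding is_max_success_prob_def eq
    by (intro conjI allI impI success_prob_attained success_prob_upper assms(2))
qed

end
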